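(* Let $\Omega=[0,1]$, $\lambda>0$, $p\in[1,2]$, and assume that $g\in L^\infty(\Omega)\cap\mathrm{Lip}(s,L^q(\Omega))$ with $s\in\,]0,1]$ and $q\in[2/(3-p),2]$. Suppose moreover that $K(x,y)=J(|x-y|)$ for all $(x,y)\in\Omega^2$, with $J$ a nonnegative bounded measurable mapping on $\Omega$. Let $u^\star$ and $u_n^\star$ be the unique minimizers of $E_\lambda(\cdot,g,K)$ over $L^2(\Omega)$ and of $E_{n,\lambda}(\cdot,g_n,K_n)$ over $\mathbb{R}^n$, respectively. Then the following error bounds hold. (i) If $p\in[1,2[$ and $K\in\mathrm{Lip}(s',L^{q'}(\Omega^2))$ with $(s',q')\in\,]0,1]\times[1,+\infty[$, then $$\|I_nu_n^\star-u^\star\|_{L^2(\Omega)}^2\le C\,n^{-\min(sq/2,\ s',\ s'q'(1-p/2))},$$ where $C$ is a positive constant independent of $n$. In particular, if $g\in L^\infty(\Omega)\cap\mathrm{BV}(\Omega)$ and $K\in L^\infty(\Omega^2)\cap\mathrm{BV}(\Omega^2)$, then $$\|I_nu_n^\star-u^\star\|_{L^2(\Omega)}^2=O\big(n^{p/2-1}\big).$$ (ii) If $p\in[1,2]$ and $K\in\mathrm{Lip}(s',L^{q'}(\Omega^2))$ with $(s',q')\in\,]0,1]\times[2/(2-p),+\infty]$, then $$\|I_nu_n^\star-u^\star\|_{L^2(\Omega)}^2\le C\,n^{-\min(sq/2,\ s')},$$ where $C$ is a positive constant independent of $n$. In particular, if $g\in L^\infty(\Omega)\cap\mathrm{BV}(\Omega)$,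 then $$\|I_nu_n^\star-u^\star\|_{L^2(\Omega)}^2=O\big(n^{-\min(1/2,\ s')}\big).$$
   Context: $\Omega=[0,1]$; by convention $2/(2-p)=+\infty$ when $p=2$. For $u\in L^2(\Omega)$, $$\mathcal{R}_p(u,K)=\frac{1}{2p}\int_{\Omega^2}K(x,y)|u(y)-u(x)|^p\,dx\,dy$$ if this integral is finite and $+\infty$ otherwise, and $E_\lambda(u,g,K)=\frac{1}{2\lambda}\|u-g\|_{L^2(\Omega)}^2+\mathcal{R}_p(u,K)$. For $n\in\mathbb{N}^*$ let $\Omega_i^{(n)}=[\frac{i-1}{n},\frac{i}{n}[$, $i=1,\dots,n$, and $\Omega_{ij}^{(n)}=\Omega_i^{(n)}\times\Omega_j^{(n)}$. Set $g_n=(g_{ni})_i$ with $g_{ni}=n\int_{\Omega_i^{(n)}}g(x)\,dx$, $K_n=(K_{nij})_{i,j}$ with $K_{nij}=n^2\int_{\Omega_{ij}^{(n)}}K(x,y)\,dx\,dy$, and $I_nv_n(x)=\sum_{i=1}^nv_{ni}\mathbf{1}_{\Omega_i^{(n)}}(x)$ for $v_n\in\mathbb{R}^n$. For $u_n\in\mathbb{R}^n$, $$E_{n,\lambda}(u_n,g_n,K_n)=\frac{1}{2\lambda n}\sum_{i=1}^n|u_{ni}-g_{ni}|^2+\frac{1}{2n^2p}\sum_{i,j=1}^nK_{nij}|u_{nj}-u_{ni}|^p.$$ Lipschitz spaces ($d\in\{1,2\}$): for $F\in L^q(\Omega^d)$, $q\in[1,+\infty]$, let $\omega(F,h)_q=\sup_{z\in\mathbb{R}^d,|z|<h}\big(\int_{\{x:\,x,x+z\in\Omega^d\}}|F(x+z)-F(x)|^q\,dx\big)^{1/q}$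 (essential supremum if $q=+\infty$); for $s\in\,]0,1]$, $\mathrm{Lip}(s,L^q(\Omega^d))$ is the set of $F\in L^q(\Omega^d)$ with $\sup_{h>0}h^{-s}\omega(F,h)_q<+\infty$. $\mathrm{BV}(\Omega^d)$ is the usual space of functions of bounded variation: $F\in L^1(\Omega^d)$ with $\sup_{h>0}h^{-1}\sum_{i=1}^d\int|F(x+he_i)-F(x)|\,dx<+\infty$, the integral being over those $x$ with $x,x+he_i\in\Omega^d$ ($e_i$ the coordinate vectors). The "in particular" statements keep the other hypotheses (on $K$, $J$, $p$), the BV hypothesis on $g$ (and on $K$ in (i)) replacing the Lipschitz-space hypothesis on it. *)

theory Defs
  imports "HOL-Probability.Essential_Supremum" "HOL-Library.Landau_Symbols"
begin

text \<open>
  Functions on \<open>\<Omega>\<close> and \<open>\<Omega> \<times> \<Omega>\<close> are represented by Lebesgue measurable representatives;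
  everything below depends only on their classes modulo almost everywhere equality.
\<close>

definition Omega :: "real set" where
  "Omega = {0..1}"

definition Lp_norm :: "ereal \<Rightarrow> 'a::euclidean_space set \<Rightarrow> ('a \<Rightarrow> real) \<Rightarrow> ennreal" where
  "Lp_norm q S F =
     (if q = \<infinity> then esssup (lebesgue_on S) (\<lambda>x. ennreal \<bar>F x\<bar>)
      else let I = (\<integral>\<^sup>+x. ennreal (\<bar>F x\<bar> powr real_of_ereal q) \<partial>lebesgue_on S)
           in if I = \<infinity> then \<infinity> else ennreal (enn2real I powr (1 / real_of_ereal q)))"

definition Lp_space :: "ereal \<Rightarrow> 'a::euclidean_space set \<Rightarrow> ('a \<Rightarrow> real) set" where
  "Lp_space q S = {F. F \<in> borel_measurable (lebesgue_on S) \<and> Lp_norm q S F < \<infinity>}"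

text \<open>Real valued, hence meaningful only on \<open>Lp_space 2 Omega\<close>.\<close>

definition L2_norm :: "(real \<Rightarrow> real) \<Rightarrow> real" where
  "L2_norm F = enn2real (Lp_norm 2 Omega F)"

definition modulus ::
    "ereal \<Rightarrow> 'a::euclidean_space set \<Rightarrow> ('a \<Rightarrow> real) \<Rightarrow> real \<Rightarrow> ennreal" where
  "modulus q S F h =
     (SUP z\<in>{z. norm z < h}. Lp_norm q {x. x \<in> S \<and> x + z \<in> S} (\<lambda>x. F (x + z) - F x))"

definition Lip_space :: "real \<Rightarrow> ereal \<Rightarrow> 'a::euclidean_space set \<Rightarrow> ('a \<Rightarrow> real) set" where
  "Lip_space s q S =
     {F \<in> Lp_space q S. (SUP h\<in>{0<..}. ennreal (h powr (- s)) * modulus q S F h) < \<infinity>}"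

definition BV_space :: "'a::euclidean_space set \<Rightarrow> ('a \<Rightarrow> real) set" where
  "BV_space S =
     {F \<in> Lp_space 1 S.
        (SUP h\<in>{0<..}. ennreal (1 / h) *
           (\<Sum>e\<in>Basis. \<integral>\<^sup>+x. ennreal \<bar>F (x + h *\<^sub>R e) - F x\<bar>
                         \<partial>lebesgue_on {x. x \<in> S \<and> x + h *\<^sub>R e \<in> S})) < \<infinity>}"

definition nonlocal_reg :: "real \<Rightarrow> (real \<Rightarrow> real) \<Rightarrow> (real \<times> real \<Rightarrow> real) \<Rightarrow> ereal" where
  "nonlocal_reg p u K =
     (if integrable (lebesgue_on (Omega \<times> Omega)) (\<lambda>(x, y). K (x, y) * \<bar>u y - u x\<bar> powr p)
      then ereal (1 / (2 * p) *
             (LINT (x, y)|lebesgue_on (Omega \<times> Omega). K (x, y) * \<bar>u y - u x\<bar> powr p))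
      else \<infinity>)"

definition energy ::
    "real \<Rightarrow> real \<Rightarrow> (real \<Rightarrow> real) \<Rightarrow> (real \<times> real \<Rightarrow> real) \<Rightarrow> (real \<Rightarrow> real) \<Rightarrow> ereal" where
  "energy lam p g K u =
     ereal (1 / (2 * lam) * (L2_norm (\<lambda>x. u x - g x))\<^sup>2) + nonlocal_reg p u K"

definition cell :: "nat \<Rightarrow> nat \<Rightarrow> real set" where
  "cell n i = {(real i - 1) / real n ..< real i / real n}"

definition discretize :: "nat \<Rightarrow> (real \<Rightarrow> real) \<Rightarrow> nat \<Rightarrow> real" where
  "discretize n g i = real n * (LINT x|lebesgue_on (cell n i). g x)"

definition discretize_kernel :: "nat \<Rightarrow> (real \<times> real \<Rightarrow> real) \<Rightarrow> nat \<Rightarrow> nat \<Rightarrow> real" where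
  "discretize_kernel n K i j = (real n)\<^sup>2 * (LINT z|lebesgue_on (cell n i \<times> cell n j). K z)"

definition interpolate :: "nat \<Rightarrow> (nat \<Rightarrow> real) \<Rightarrow> real \<Rightarrow> real" where
  "interpolate n v x = (\<Sum>i=1..n. v i * indicator (cell n i) x)"

text \<open>\<open>\<real>\<^sup>n\<close>, with coordinates indexed by \<open>1, \<dots>, n\<close> and the junk value \<open>undefined\<close> elsewhere.\<close>

definition vecs :: "nat \<Rightarrow> (nat \<Rightarrow> real) set" where
  "vecs n = {1..n} \<rightarrow>\<^sub>E UNIV"

definition discrete_energy ::
    "nat \<Rightarrow> real \<Rightarrow> real \<Rightarrow> (nat \<Rightarrow> real) \<Rightarrow> (nat \<Rightarrow> nat \<Rightarrow> real) \<Rightarrow> (nat \<Rightarrow> real) \<Rightarrow> real" where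
  "discrete_energy n lam p gn Kn v =
     1 / (2 * lam * real n) * (\<Sum>i=1..n. \<bar>v i - gn i\<bar>\<^sup>2)
     + 1 / (2 * (real n)\<^sup>2 * p) * (\<Sum>i=1..n. \<Sum>j=1..n. Kn i j * \<bar>v j - v i\<bar> powr p)"

text \<open>\<open>2 / (2 - p)\<close>, read as \<open>\<infinity>\<close> for \<open>p = 2\<close>.\<close>

definition exponent_bound :: "real \<Rightarrow> ereal" where
  "exponent_bound p = (if p = 2 then \<infinity> else ereal (2 / (2 - p)))"

end

theory Submission
  imports Defs
begin

text \<open>
  Cell averaging makes the discrete problem an exact Galerkin scheme: since \<open>K\<close> enters the energy of
  a step function only through its cell means, and since the fidelity term splits orthogonally on
  each cell, the discrete energy of \<open>v\<close> is the continuous energy of its interpolant up to a constant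
  independent of \<open>v\<close>. Hence \<open>I\<^sub>nu\<^sub>n\<close> minimizes \<open>E\<^sub>\<lambda>\<close> over step functions. Strong convexity then bounds
  \<open>\<parallel>I\<^sub>nu\<^sub>n - u\<parallel>\<^sup>2\<close> by a multiple of \<open>E\<^sub>\<lambda>(P\<^sub>nu) - E\<^sub>\<lambda>(u)\<close>, where \<open>P\<^sub>n\<close> denotes averaging over cells.
  By Jensen's inequality on products of cells and the bound \<open>\<bar>u\<bar> \<le> \<parallel>g\<parallel>\<^sub>\<infinity>\<close>, this difference is at most
  a constant times \<open>\<parallel>g - P\<^sub>ng\<parallel>\<^sub>1 + \<parallel>K - P\<^sub>nK\<parallel>\<^sub>1\<close>; the regularity of \<open>u\<close> plays no role.
  Both norms are controlled by the \<open>L\<^sup>1\<close> modulus of smoothness, so the rate is in fact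
  \<open>n\<^sup>-\<^sup>s + n\<^sup>-\<^sup>s\<^sup>'\<close>, with exponent \<open>1\<close> for BV functions.
  Since \<open>sq/2 \<le> s\<close>, this is at least as good as each claimed rate.
\<close>

section \<open>Means on finite measure spaces\<close>

text \<open>Errors of the data are measured in L1 although the energy contains squares and powers
  \<open>p\<close>. The common bound \<open>M\<close> on \<open>g\<close> and \<open>u\<close> makes
  this possible: the square of the deviation of \<open>g\<close> from its cell mean is at most
  \<open>2 * M\<close> times its modulus, and \<open>\<bar>u y - u x\<bar> powr p\<close> is at most
  \<open>(2 * M) powr p\<close>, which multiplies the kernel error. Clamping to the interval from
  \<open>- M\<close> to \<open>M\<close> does not raise the energy, which supplies the bound on
  \<open>u\<close>. The obstacle is measure-theoretic: the data are Lebesgue measurable on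
  \<open>Omega\<close> and matter only up to null sets, while translation and Tonelli are carried
  out for Borel functions under \<open>lborel\<close>. So \<open>g\<close>, \<open>K\<close> and
  \<open>u\<close> are exchanged for Borel representatives, bounded everywhere, and smoothness
  enters only through \<open>shift_L1\<close>, the L1 size of \<open>F (x + z) - F x\<close>, which
  does not depend on the representative. The price of averaging is the volume of a box containing
  all differences within a cell, divided by the volume of the cell: \<open>2\<close> on the line,
  \<open>4\<close> in the plane.\<close>

lemma powr_above_tangent:
  fixes a x p :: real
  assumes "a \<ge> 0" "x \<ge> 0" "p \<ge> 1"
  shows "a powr p + p * a powr (p - 1) * (x - a) \<le> x powr p"
proof (cases "p = 1 \<or> a = 0")
  case True
  then show ?thesis using assms by auto
next
  case False
  then have p: "p > 1" and a: "a > 0" using assms by auto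
  \<comment> \<open>Young's inequality with the conjugate exponents \<open>p\<close> and
    \<open>p / (p - 1)\<close> gives the tangent bound without any derivative; it requires
    \<open>p > 1\<close>. The excluded cases are direct, since \<open>0 powr y = 0\<close> also for
    \<open>y = 0\<close>.\<close>
  have "x * a powr (p - 1) \<le> x powr p / p + (a powr (p - 1)) powr (p / (p - 1)) / (p / (p - 1))"
    by (rule Youngs_inequality) (use p assms in \<open>auto simp: field_simps\<close>)
  also have "(a powr (p - 1)) powr (p / (p - 1)) = a powr p"
    using p by (simp add: powr_powr)
  finally have "p * (x * a powr (p - 1)) \<le> x powr p + a powr p * (p - 1)"
    using p by (simp add: field_simps)
  moreover have "a powr (p - 1) * a = a powr p"
    using a by (simp add: powr_diff)
  ultimately show ?thesis by (simp add: algebra_simps)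
qed

text \<open>Both tangent bounds are taken at \<open>c\<close>, the mean of
  \<open>\<bar>a\<bar>\<close> and \<open>\<bar>b\<bar>\<close>, so that their first-order terms
  cancel in the sum. It makes the regularization term convex.\<close>

lemma abs_powr_midpoint:
  fixes a b p :: real
  assumes "p \<ge> 1"
  shows "\<bar>(a + b) / 2\<bar> powr p \<le> (\<bar>a\<bar> powr p + \<bar>b\<bar> powr p) / 2"
proof -
  define c where "c = (\<bar>a\<bar> + \<bar>b\<bar>) / 2"
  have "c \<ge> 0" by (simp add: c_def)
  have "\<bar>(a + b) / 2\<bar> powr p \<le> c powr p"
    using assms by (intro powr_mono2) (auto simp: c_def)
  moreover have "c powr p + p * c powr (p - 1) * (\<bar>a\<bar> - c) \<le> \<bar>a\<bar> powr p"
    "c powr p + p * c powr (p - 1) * (\<bar>b\<bar> - c) \<le> \<bar>b\<bar> powr p"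
    using powr_above_tangent[OF \<open>c \<ge> 0\<close> _ assms] by auto
  moreover have "p * c powr (p - 1) * (\<bar>a\<bar> - c) + p * c powr (p - 1) * (\<bar>b\<bar> - c) = 0"
    by (simp add: c_def field_simps)
  ultimately show ?thesis by (simp add: field_simps)
qed

text \<open>Jensen's inequality, by integrating the tangent at \<open>a\<close>, the modulus of the
  mean. The first-order term need not vanish, but it is nonnegative because \<open>m * a\<close> is
  at most the integral of \<open>\<bar>f\<bar>\<close>.\<close>

lemma (in finite_measure) abs_mean_powr_le:
  fixes f :: "'a \<Rightarrow> real"
  assumes p: "p \<ge> 1" and pos: "measure M (space M) > 0"
    and f: "integrable M f" "integrable M (\<lambda>x. \<bar>f x\<bar> powr p)"
  shows "\<bar>(LINT x|M. f x) / measure M (space M)\<bar> powr p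
    \<le> (LINT x|M. \<bar>f x\<bar> powr p) / measure M (space M)"
proof -
  define m where "m = measure M (space M)"
  define a where "a = \<bar>(LINT x|M. f x) / m\<bar>"
  have "m > 0" using pos by (simp add: m_def)
  have a: "a \<ge> 0" by (simp add: a_def)
  have "(LINT x|M. a powr p + p * a powr (p - 1) * (\<bar>f x\<bar> - a)) \<le> (LINT x|M. \<bar>f x\<bar> powr p)"
    using powr_above_tangent[OF a _ p] f by (intro integral_mono) auto
  also have "(LINT x|M. a powr p + p * a powr (p - 1) * (\<bar>f x\<bar> - a))
      = m * a powr p + p * a powr (p - 1) * ((LINT x|M. \<bar>f x\<bar>) - m * a)"
    using f by (simp add: m_def)
  finally have *: "m * a powr p + p * a powr (p - 1) * ((LINT x|M. \<bar>f x\<bar>) - m * a)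
      \<le> (LINT x|M. \<bar>f x\<bar> powr p)" .
  have "m * a \<le> (LINT x|M. \<bar>f x\<bar>)"
    using \<open>m > 0\<close> integral_abs_bound[of M f] by (simp add: a_def)
  then have "0 \<le> p * a powr (p - 1) * ((LINT x|M. \<bar>f x\<bar>) - m * a)"
    using p by simp
  with * have "m * a powr p \<le> (LINT x|M. \<bar>f x\<bar> powr p)" by linarith
  then show ?thesis using \<open>m > 0\<close> by (simp add: a_def m_def field_simps)
qed

text \<open>The bias-variance identity. With \<open>c\<close> the value of a step function on a cell
  it separates the discrete fidelity from the variance of \<open>g\<close>; with
  \<open>c = 0\<close> it bounds a squared mean by a mean square.\<close>

lemma (in finite_measure) integral_square_about_mean:
  fixes f :: "'a \<Rightarrow> real"
  assumes pos: "measure M (space M) > 0"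
    and f: "integrable M f" "integrable M (\<lambda>x. (f x)\<^sup>2)"
  defines "a \<equiv> (LINT x|M. f x) / measure M (space M)"
  shows "(LINT x|M. (c - f x)\<^sup>2) = measure M (space M) * (c - a)\<^sup>2 + (LINT x|M. (f x - a)\<^sup>2)"
proof -
  have e: "(LINT x|M. (f x - b)\<^sup>2)
      = (LINT x|M. (f x)\<^sup>2) - 2 * b * (LINT x|M. f x) + measure M (space M) * b\<^sup>2" for b
  proof -
    have "(LINT x|M. (f x - b)\<^sup>2) = (LINT x|M. (f x)\<^sup>2 - 2 * b * f x + b\<^sup>2)"
      by (simp add: power2_diff algebra_simps)
    then show ?thesis using f by simp
  qed
  have "(LINT x|M. (c - f x)\<^sup>2) = (LINT x|M. (f x - c)\<^sup>2)"
    by (simp add: power2_commute)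
  moreover have "(LINT x|M. f x) = measure M (space M) * a"
    using pos by (simp add: a_def)
  ultimately show ?thesis
    unfolding e by (simp add: power2_eq_square algebra_simps)
qed

lemma nn_integral_lborel_shift:
  fixes f :: "'a::euclidean_space \<Rightarrow> ennreal"
  assumes [measurable]: "f \<in> borel_measurable borel"
  shows "(\<integral>\<^sup>+y. f y \<partial>lborel) = (\<integral>\<^sup>+z. f (x + z) \<partial>lborel)"
proof -
  have "(\<integral>\<^sup>+y. f y \<partial>lborel) = (\<integral>\<^sup>+y. f y \<partial>distr lborel borel ((+) x))"
    by (simp add: lborel_distr_plus)
  then show ?thesis by (subst (asm) nn_integral_distr) auto
qed

section \<open>Deviation from cell means in terms of L1 shifts\<close>

text \<open>The quantity to which both Lipschitz and BV hypotheses are reduced. An indicator under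
  \<open>lborel\<close>, instead of a restricted measure, keeps the measure independent of
  \<open>z\<close>, so that translation and Tonelli apply directly.\<close>

definition shift_L1 :: "'a::euclidean_space set \<Rightarrow> ('a \<Rightarrow> real) \<Rightarrow> 'a \<Rightarrow> ennreal" where
  "shift_L1 S F z =
     (\<integral>\<^sup>+x. ennreal \<bar>F (x + z) - F x\<bar> * indicator {x. x \<in> S \<and> x + z \<in> S} x \<partial>lborel)"

text \<open>A deviation from the mean is at most the mean of the deviations, so each cell
  contributes a double integral of \<open>\<bar>F y - F x\<bar>\<close>. After the substitution
  \<open>y = x + z\<close> and an exchange of the integrals, the disjoint cells together count each
  \<open>x\<close> at most once for a given \<open>z\<close>, and only shifts \<open>z\<close> in
  \<open>B\<close> occur.\<close>

lemma sum_cells_mean_deviation: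
  fixes F :: "'a::euclidean_space \<Rightarrow> real" and Q :: "'i \<Rightarrow> 'a set"
  assumes F[measurable]: "F \<in> borel_measurable borel"
    and I: "finite I" "disjoint_family_on Q I"
    and Q[measurable]: "\<And>i. i \<in> I \<Longrightarrow> Q i \<in> sets borel" and QS: "\<And>i. i \<in> I \<Longrightarrow> Q i \<subseteq> S"
    and m: "m > 0" "\<And>i. i \<in> I \<Longrightarrow> emeasure lborel (Q i) = ennreal m"
    and int: "\<And>i. i \<in> I \<Longrightarrow> set_integrable lborel (Q i) F"
    and S[measurable]: "S \<in> sets borel"
    and B[measurable]: "B \<in> sets borel"
    and QB: "\<And>i x y. i \<in> I \<Longrightarrow> x \<in> Q i \<Longrightarrow> y \<in> Q i \<Longrightarrow> y - x \<in> B"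
    and bd: "\<And>z. z \<in> B \<Longrightarrow> shift_L1 S F z \<le> c"
  shows "(\<Sum>i\<in>I. \<integral>\<^sup>+x. ennreal \<bar>F x - (LINT y:Q i|lborel. F y) / m\<bar> * indicator (Q i) x \<partial>lborel)
    \<le> ennreal (1 / m) * (c * emeasure lborel B)"
proof -
  have one: "(\<integral>\<^sup>+x. ennreal \<bar>F x - (LINT y:Q i|lborel. F y) / m\<bar> * indicator (Q i) x \<partial>lborel)
      \<le> ennreal (1 / m) * (\<integral>\<^sup>+z. \<integral>\<^sup>+x. ennreal \<bar>F (x + z) - F x\<bar> * (indicator (Q i) x * indicator (Q i) (x + z)) \<partial>lborel \<partial>lborel)"
    if i: "i \<in> I" for i
  proof -
    note Q[OF i, measurable]
    have mQ: "measure lborel (Q i) = m" using m i by (simp add: measure_def)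
    have fin: "emeasure lborel (Q i) < \<infinity>" using m i by simp
    have ic: "set_integrable lborel (Q i) (\<lambda>y. c)" for c :: real
      unfolding set_integrable_def using fin by (simp add: integrable_real_indicator)
    have pw: "ennreal \<bar>F x - (LINT y:Q i|lborel. F y) / m\<bar>
        \<le> ennreal (1 / m) * (\<integral>\<^sup>+y. ennreal \<bar>F y - F x\<bar> * indicator (Q i) y \<partial>lborel)" for x
    proof -
      have id: "set_integrable lborel (Q i) (\<lambda>y. F y - F x)"
        by (intro set_integral_diff int[OF i] ic)
      have c1: "(LINT y:Q i|lborel. F x) = m * F x"
        using fin by (subst set_integral_const) (auto simp: mQ)
      have "m * (F x - (LINT y:Q i|lborel. F y) / m) = - (LINT y:Q i|lborel. F y - F x)"
        using m(1) by (subst set_integral_diff(2)[OF int[OF i] ic]) (simp add: c1 field_simps)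
      then have "m * \<bar>F x - (LINT y:Q i|lborel. F y) / m\<bar> = \<bar>LINT y:Q i|lborel. F y - F x\<bar>"
        using m(1) by (metis abs_minus_cancel abs_mult abs_of_pos)
      also have "\<dots> \<le> (LINT y|lborel. \<bar>indicator (Q i) y *\<^sub>R (F y - F x)\<bar>)"
        unfolding set_lebesgue_integral_def by (rule integral_abs_bound)
      finally have "\<bar>F x - (LINT y:Q i|lborel. F y) / m\<bar>
          \<le> (1 / m) * (LINT y|lborel. \<bar>indicator (Q i) y *\<^sub>R (F y - F x)\<bar>)"
        using m(1) by (simp add: field_simps)
      then have "ennreal \<bar>F x - (LINT y:Q i|lborel. F y) / m\<bar>
          \<le> ennreal (1 / m) * ennreal (LINT y|lborel. \<bar>indicator (Q i) y *\<^sub>R (F y - F x)\<bar>)"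
        using m(1) by (simp add: ennreal_mult'[symmetric] ennreal_leI)
      also have "ennreal (LINT y|lborel. \<bar>indicator (Q i) y *\<^sub>R (F y - F x)\<bar>)
          = (\<integral>\<^sup>+y. ennreal \<bar>indicator (Q i) y *\<^sub>R (F y - F x)\<bar> \<partial>lborel)"
        using id unfolding set_integrable_def by (intro nn_integral_eq_integral[symmetric]) auto
      also have "\<dots> = (\<integral>\<^sup>+y. ennreal \<bar>F y - F x\<bar> * indicator (Q i) y \<partial>lborel)"
        by (intro nn_integral_cong) (auto split: split_indicator)
      finally show ?thesis .
    qed
    have "(\<integral>\<^sup>+x. ennreal \<bar>F x - (LINT y:Q i|lborel. F y) / m\<bar> * indicator (Q i) x \<partial>lborel)
        \<le> (\<integral>\<^sup>+x. ennreal (1 / m) * (\<integral>\<^sup>+y. ennreal \<bar>F y - F x\<bar> * indicator (Q i) y \<partial>lborel) * indicator (Q i) x \<partial>lborel)"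
      by (intro nn_integral_mono mult_right_mono pw) auto
    also have "\<dots> = (\<integral>\<^sup>+x. ennreal (1 / m) * ((\<integral>\<^sup>+z. ennreal \<bar>F (x + z) - F x\<bar> * indicator (Q i) (x + z) \<partial>lborel) * indicator (Q i) x) \<partial>lborel)"
    proof (intro nn_integral_cong)
      fix x
      have "(\<integral>\<^sup>+y. ennreal \<bar>F y - F x\<bar> * indicator (Q i) y \<partial>lborel)
          = (\<integral>\<^sup>+z. ennreal \<bar>F (x + z) - F x\<bar> * indicator (Q i) (x + z) \<partial>lborel)"
        by (rule nn_integral_lborel_shift) measurable
      then show "ennreal (1 / m) * (\<integral>\<^sup>+y. ennreal \<bar>F y - F x\<bar> * indicator (Q i) y \<partial>lborel) * indicator (Q i) x
          = ennreal (1 / m) * ((\<integral>\<^sup>+z. ennreal \<bar>F (x + z) - F x\<bar> * indicator (Q i) (x + z) \<partial>lborel) * indicator (Q i) x)"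
        by (simp add: mult.assoc)
    qed
    also have "\<dots> = ennreal (1 / m) * (\<integral>\<^sup>+x. (\<integral>\<^sup>+z. ennreal \<bar>F (x + z) - F x\<bar> * indicator (Q i) (x + z) \<partial>lborel) * indicator (Q i) x \<partial>lborel)"
      by (intro nn_integral_cmult) measurable
    also have "(\<integral>\<^sup>+x. (\<integral>\<^sup>+z. ennreal \<bar>F (x + z) - F x\<bar> * indicator (Q i) (x + z) \<partial>lborel) * indicator (Q i) x \<partial>lborel)
       = (\<integral>\<^sup>+x. \<integral>\<^sup>+z. ennreal \<bar>F (x + z) - F x\<bar> * (indicator (Q i) x * indicator (Q i) (x + z)) \<partial>lborel \<partial>lborel)"
      by (intro nn_integral_cong, subst nn_integral_multc[symmetric]) (auto simp: mult_ac)
    also have "\<dots> = (\<integral>\<^sup>+z. \<integral>\<^sup>+x. ennreal \<bar>F (x + z) - F x\<bar> * (indicator (Q i) x * indicator (Q i) (x + z)) \<partial>lborel \<partial>lborel)"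
      by (rule lborel_pair.Fubini'[symmetric]) measurable
    finally show ?thesis .
  qed
  have ms: "(\<lambda>z. \<integral>\<^sup>+x. ennreal \<bar>F (x + z) - F x\<bar> * (indicator (Q i) x * indicator (Q i) (x + z)) \<partial>lborel) \<in> borel_measurable lborel"
     "(\<lambda>x. ennreal \<bar>F (x + z) - F x\<bar> * (indicator (Q i) x * indicator (Q i) (x + z))) \<in> borel_measurable lborel"
    if i: "i \<in> I" for i z
  proof -
    note Q[OF i, measurable]
    show "(\<lambda>z. \<integral>\<^sup>+x. ennreal \<bar>F (x + z) - F x\<bar> * (indicator (Q i) x * indicator (Q i) (x + z)) \<partial>lborel) \<in> borel_measurable lborel"
      "(\<lambda>x. ennreal \<bar>F (x + z) - F x\<bar> * (indicator (Q i) x * indicator (Q i) (x + z))) \<in> borel_measurable lborel"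
      by measurable
  qed
  \<comment> \<open>At most one cell contains \<open>x\<close>, so the sum is \<open>0\<close> or
    \<open>1\<close>. If it is \<open>1\<close>, both points lie in \<open>S\<close>, and
    \<open>z\<close> is a difference of two points of one cell, hence in \<open>B\<close>.\<close>
  have ind: "(\<Sum>i\<in>I. indicator (Q i) x * indicator (Q i) (x + z))
      \<le> (indicator {x. x \<in> S \<and> x + z \<in> S} x * indicator B z :: ennreal)" for x z
  proof (cases "\<exists>i\<in>I. x \<in> Q i \<and> x + z \<in> Q i")
    case True
    then obtain i where i: "i \<in> I" "x \<in> Q i" "x + z \<in> Q i" by blast
    have ji: "j = i" if "j \<in> I" "x \<in> Q j" for j
    proof (rule ccontr)
      assume "j \<noteq> i"
      then have "Q j \<inter> Q i = {}" using I(2) i(1) that(1) by (auto simp: disjoint_family_on_def)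
      then show False using that(2) i(2) by auto
    qed
    have "(\<Sum>j\<in>I. indicator (Q j) x * indicator (Q j) (x + z)) = (\<Sum>j\<in>I. if j = i then 1 else 0 :: ennreal)"
    proof (rule sum.cong)
      fix j assume "j \<in> I"
      show "indicator (Q j) x * indicator (Q j) (x + z) = (if j = i then 1 else 0 :: ennreal)"
        using ji[OF \<open>j \<in> I\<close>] i by (cases "j = i") (auto simp: indicator_def)
    qed simp
    also have "\<dots> = 1"
      using I(1) i(1) by simp
    moreover have "x \<in> S" "x + z \<in> S" "z \<in> B"
      using QS[OF i(1)] QB[OF i] i by auto
    ultimately show ?thesis by simp
  next
    case False
    then have "(\<Sum>i\<in>I. indicator (Q i) x * indicator (Q i) (x + z)) = (0::ennreal)"
      by (intro sum.neutral) (auto simp: indicator_def)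
    then show ?thesis by simp
  qed
  have "(\<Sum>i\<in>I. \<integral>\<^sup>+x. ennreal \<bar>F x - (LINT y:Q i|lborel. F y) / m\<bar> * indicator (Q i) x \<partial>lborel)
      \<le> (\<Sum>i\<in>I. ennreal (1 / m) * (\<integral>\<^sup>+z. \<integral>\<^sup>+x. ennreal \<bar>F (x + z) - F x\<bar> * (indicator (Q i) x * indicator (Q i) (x + z)) \<partial>lborel \<partial>lborel))"
    by (intro sum_mono one)
  also have "\<dots> = ennreal (1 / m) * (\<integral>\<^sup>+z. \<integral>\<^sup>+x. ennreal \<bar>F (x + z) - F x\<bar> * (\<Sum>i\<in>I. indicator (Q i) x * indicator (Q i) (x + z)) \<partial>lborel \<partial>lborel)"
    unfolding sum_distrib_left[symmetric]
    by (subst nn_integral_sum[symmetric], use ms in \<open>simp; fail\<close>)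
       (intro arg_cong[where f="(*) (ennreal (1/m))"] nn_integral_cong,
        subst nn_integral_sum[symmetric], use ms in \<open>auto simp: sum_distrib_left\<close>)
  also have "\<dots> \<le> ennreal (1 / m) * (\<integral>\<^sup>+z. c * indicator B z \<partial>lborel)"
  proof (intro mult_left_mono nn_integral_mono)
    fix z
    have "(\<integral>\<^sup>+x. ennreal \<bar>F (x + z) - F x\<bar> * (\<Sum>i\<in>I. indicator (Q i) x * indicator (Q i) (x + z)) \<partial>lborel)
       \<le> (\<integral>\<^sup>+x. ennreal \<bar>F (x + z) - F x\<bar> * (indicator {x. x \<in> S \<and> x + z \<in> S} x * indicator B z) \<partial>lborel)"
      by (intro nn_integral_mono mult_left_mono ind) auto
    also have "\<dots> = shift_L1 S F z * indicator B z"
      unfolding shift_L1_def by (subst nn_integral_multc[symmetric]) (auto simp: mult_ac)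
    also have "\<dots> \<le> c * indicator B z"
      using bd[of z] by (auto simp: indicator_def)
    finally show "(\<integral>\<^sup>+x. ennreal \<bar>F (x + z) - F x\<bar> * (\<Sum>i\<in>I. indicator (Q i) x * indicator (Q i) (x + z)) \<partial>lborel) \<le> c * indicator B z" .
  qed auto
  also have "(\<integral>\<^sup>+z. c * indicator B z \<partial>lborel) = c * emeasure lborel B"
    by (rule nn_integral_cmult_indicator) auto
  finally show ?thesis .
qed

section \<open>The \<open>L\<^sup>1\<close> modulus of Lipschitz and BV functions\<close>

lemma nn_integral_lebesgue_on_eq:
  fixes f :: "'a::euclidean_space \<Rightarrow> ennreal"
  assumes S: "S \<in> sets borel"
  shows "(\<integral>\<^sup>+x. f x \<partial>lebesgue_on S) = (\<integral>\<^sup>+x. f x * indicator S x \<partial>lborel)"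
  using S by (subst nn_integral_restrict_space) (auto simp: nn_integral_completion)

lemma AE_lebesgue_on_iff:
  fixes S :: "'a::euclidean_space set"
  assumes S: "S \<in> sets borel"
  shows "(AE x in lebesgue_on S. P x) \<longleftrightarrow> (AE x in lborel. x \<in> S \<longrightarrow> P x)"
  using S by (subst AE_restrict_space_iff) (auto simp: AE_completion_iff)

lemma borel_measurable_lebesgue_onI:
  fixes f :: "'a::euclidean_space \<Rightarrow> 'b::topological_space"
  assumes "f \<in> borel_measurable borel"
  shows "f \<in> borel_measurable (lebesgue_on S)"
  using assms by (intro measurable_restrict_space1 measurable_completion) simp

lemma AE_lborel_translate:
  fixes P :: "'a::euclidean_space \<Rightarrow> bool"
  assumes "AE x in lborel. P x"
  shows "AE x in lborel. P (x + z)"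
proof -
  obtain N where N: "N \<in> null_sets lborel" "{x \<in> space lborel. \<not> P x} \<subseteq> N"
    using assms by (auto elim: AE_E simp: null_sets_def)
  have "{x. x - (-z) \<in> N} \<in> null_sets lborel"
    by (rule null_sets_translation[OF N(1)])
  then show ?thesis
    by (rule AE_I') (use N in auto)
qed

text \<open>On a set of measure at most \<open>1\<close> the \<open>q\<close>-norm controls the L1
  norm. The norm is that of the given function \<open>G\<close>, the conclusion concerns its Borel
  version \<open>F\<close>. The bound \<open>a\<close> is strictly positive because the power
  \<open>1 - r\<close> of \<open>a\<close>, which may be negative, occurs.\<close>

lemma nn_integral_le_of_Lp_norm:
  fixes F G :: "'a::euclidean_space \<Rightarrow> real"
  assumes F[measurable]: "F \<in> borel_measurable borel" and T: "T \<in> sets borel"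
    and eT: "emeasure lborel T \<le> 1"
    and eq: "AE x in lebesgue_on T. G x = F x"
    and q: "1 \<le> q" and a: "a > 0" and N: "Lp_norm q T G \<le> ennreal a"
  shows "(\<integral>\<^sup>+x. ennreal \<bar>F x\<bar> * indicator T x \<partial>lborel) \<le> ennreal (2 * a)"
proof (cases q)
  case (real r)
  then have r: "r \<ge> 1" using q by simp
  define I where "I = (\<integral>\<^sup>+x. ennreal (\<bar>G x\<bar> powr r) \<partial>lebesgue_on T)"
  have I: "I = (\<integral>\<^sup>+x. ennreal (\<bar>F x\<bar> powr r) * indicator T x \<partial>lborel)"
    unfolding I_def nn_integral_lebesgue_on_eq[OF T, symmetric]
    by (intro nn_integral_cong_AE) (use eq in auto)
  have L: "Lp_norm q T G = (if I = \<infinity> then \<infinity> else ennreal (enn2real I powr (1 / r)))"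
    using real by (simp add: Lp_norm_def I_def Let_def)
  with N have fin: "I \<noteq> \<infinity>" by (auto simp: top_unique)
  with L N a have "enn2real I powr (1 / r) \<le> a" by (simp add: ennreal_le_iff)
  then have "(enn2real I powr (1 / r)) powr r \<le> a powr r"
    using r by (intro powr_mono2) auto
  then have "enn2real I \<le> a powr r" using r by (simp add: powr_powr)
  then have Ia: "I \<le> ennreal (a powr r)"
    using fin by (metis ennreal_enn2real_if ennreal_leI infinity_ennreal_def)
  \<comment> \<open>\<open>t \<le> a + a\<^sup>1\<^sup>-\<^sup>r t\<^sup>r\<close> replaces Hoelder's inequality, at the cost of a factor \<open>2\<close>.\<close>
  have pw: "t \<le> a + a powr (1 - r) * t powr r" if "t \<ge> 0" for t
  proof (cases "t \<le> a")
    case True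
    then show ?thesis by (simp add: add_increasing2)
  next
    case False
    have "t = a powr (1 - r) * (a powr (r - 1) * t)"
      using a by (simp add: mult.assoc[symmetric] powr_add[symmetric])
    also have "\<dots> \<le> a powr (1 - r) * (t powr (r - 1) * t)"
      using False a r by (intro mult_left_mono mult_right_mono powr_mono2) auto
    also have "t powr (r - 1) * t = t powr r"
      using False a by (simp add: powr_diff)
    finally show ?thesis using a by linarith
  qed
  have "(\<integral>\<^sup>+x. ennreal \<bar>F x\<bar> * indicator T x \<partial>lborel)
      \<le> (\<integral>\<^sup>+x. ennreal a * indicator T x + ennreal (a powr (1 - r)) * (ennreal (\<bar>F x\<bar> powr r) * indicator T x) \<partial>lborel)"
  proof (intro nn_integral_mono)
    fix x
    have "ennreal \<bar>F x\<bar> \<le> ennreal a + ennreal (a powr (1 - r)) * ennreal (\<bar>F x\<bar> powr r)"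
      using pw[of "\<bar>F x\<bar>"] a by (simp add: ennreal_mult'[symmetric] ennreal_plus[symmetric] ennreal_leI del: ennreal_plus)
    then show "ennreal \<bar>F x\<bar> * indicator T x \<le> ennreal a * indicator T x + ennreal (a powr (1 - r)) * (ennreal (\<bar>F x\<bar> powr r) * indicator T x)"
      by (auto simp: indicator_def)
  qed
  also have "\<dots> = ennreal a * emeasure lborel T + ennreal (a powr (1 - r)) * I"
    unfolding I using T by (subst nn_integral_add) (auto simp: nn_integral_cmult)
  also have "\<dots> \<le> ennreal a * 1 + ennreal (a powr (1 - r)) * ennreal (a powr r)"
    by (intro add_mono mult_left_mono eT Ia) auto
  also have "\<dots> = ennreal (2 * a)"
    using a by (simp add: ennreal_mult'[symmetric] ennreal_plus[symmetric] powr_add[symmetric] del: ennreal_plus)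
  finally show ?thesis .
next
  case PInf
  then have "esssup (lebesgue_on T) (\<lambda>x. ennreal \<bar>G x\<bar>) \<le> ennreal a"
    using N by (simp add: Lp_norm_def)
  then have "AE x in lebesgue_on T. ennreal \<bar>G x\<bar> \<le> ennreal a"
    using esssup_AE[of "\<lambda>x. ennreal \<bar>G x\<bar>" "lebesgue_on T"] by (auto elim: eventually_mono)
  with eq have "AE x in lebesgue_on T. ennreal \<bar>F x\<bar> \<le> ennreal a"
    by (auto elim: eventually_elim2)
  then have "AE x in lborel. ennreal \<bar>F x\<bar> * indicator T x \<le> ennreal a * indicator T x"
    unfolding AE_lebesgue_on_iff[OF T] by (auto elim!: eventually_mono simp: indicator_def)
  then have "(\<integral>\<^sup>+x. ennreal \<bar>F x\<bar> * indicator T x \<partial>lborel) \<le> (\<integral>\<^sup>+x. ennreal a * indicator T x \<partial>lborel)"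
    by (rule nn_integral_mono_AE)
  also have "\<dots> = ennreal a * emeasure lborel T"
    using T by (simp add: nn_integral_cmult_indicator)
  also have "\<dots> \<le> ennreal a * 1" by (intro mult_left_mono eT) auto
  also have "\<dots> \<le> ennreal (2 * a)" using a by (simp add: ennreal_leI)
  finally show ?thesis .
qed (use q in auto)

lemma shift_set_measurable:
  fixes S :: "'a::euclidean_space set"
  assumes [measurable]: "S \<in> sets borel"
  shows "{x. x \<in> S \<and> x + z \<in> S} \<in> sets borel"
  by measurable

lemma AE_shift_difference:
  fixes F F' :: "'a::euclidean_space \<Rightarrow> real"
  assumes S: "S \<in> sets borel" and eq: "AE x in lebesgue_on S. F x = F' x"
  shows "AE x in lebesgue_on {x. x \<in> S \<and> x + z \<in> S}. F (x + z) - F x = F' (x + z) - F' x"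
proof -
  have "AE x in lborel. x \<in> S \<longrightarrow> F x = F' x"
    using eq unfolding AE_lebesgue_on_iff[OF S] .
  moreover from AE_lborel_translate[OF this, of z]
  have "AE x in lborel. x + z \<in> S \<longrightarrow> F (x + z) = F' (x + z)" .
  ultimately show ?thesis
    unfolding AE_lebesgue_on_iff[OF shift_set_measurable[OF S]] by eventually_elim auto
qed

text \<open>Every integrability exponent \<open>q\<close> is brought down to L1 while the order
  \<open>s\<close> is kept. From here on \<open>q\<close> has disappeared, which is why it does not
  enter the rate that is finally obtained.\<close>

lemma Lip_space_shift_L1:
  fixes F F' :: "'a::euclidean_space \<Rightarrow> real"
  assumes S: "S \<in> sets borel" "emeasure lborel S \<le> 1"
    and F': "F' \<in> borel_measurable borel" and eq: "AE x in lebesgue_on S. F x = F' x"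
    and q: "1 \<le> q" and s: "s > 0" and F: "F \<in> Lip_space s q S"
  obtains C where "C \<ge> 0" "\<And>z. shift_L1 S F' z \<le> ennreal (C * norm z powr s)"
proof -
  note [measurable] = S(1) F'
  define L where "L = (SUP h\<in>{0<..}. ennreal (h powr (- s)) * modulus q S F h)"
  have "L < \<infinity>" using F by (simp add: Lip_space_def L_def)
  then obtain l where l: "L = ennreal l" "l \<ge> 0" by (cases L) auto
  have sh: "shift_L1 S F' z \<le> ennreal (2 * (l + 1) * 2 powr s * norm z powr s)" for z
  proof (cases "z = 0")
    case True
    then show ?thesis by (simp add: shift_L1_def)
  next
    case False
    \<comment> \<open>\<open>modulus\<close> takes its supremum over the open ball
      \<open>norm z < h\<close>, so \<open>h\<close> has to exceed \<open>norm z\<close>. Doubling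
      costs the factor \<open>2 powr s\<close>.\<close>
    define h where "h = 2 * norm z"
    have h: "h > 0" "norm z < h" using False by (auto simp: h_def)
    have "ennreal (h powr (- s)) * modulus q S F h \<le> ennreal l"
      unfolding l(1)[symmetric] L_def using h by (intro SUP_upper) auto
    then have "ennreal (h powr s) * (ennreal (h powr (- s)) * modulus q S F h) \<le> ennreal (h powr s) * ennreal l"
      by (intro mult_left_mono) auto
    then have "modulus q S F h \<le> ennreal (h powr s * l)"
      using h l by (simp add: mult.assoc[symmetric] ennreal_mult'[symmetric] powr_add[symmetric])
    moreover have "Lp_norm q {x. x \<in> S \<and> x + z \<in> S} (\<lambda>x. F (x + z) - F x) \<le> modulus q S F h"
      unfolding modulus_def using h by (intro SUP_upper) auto
    \<comment> \<open>The bound is enlarged from \<open>l\<close> to \<open>l + 1\<close> because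
      \<open>l\<close> may be \<open>0\<close>, while the comparison with L1 asks for a positive
      number.\<close>
    ultimately have "Lp_norm q {x. x \<in> S \<and> x + z \<in> S} (\<lambda>x. F (x + z) - F x) \<le> ennreal (h powr s * (l + 1))"
      using l h by (meson ennreal_leI mult_left_mono order_trans powr_ge_zero less_add_one less_imp_le)
    moreover have "emeasure lborel {x. x \<in> S \<and> x + z \<in> S} \<le> 1"
      using S(2) by (rule order_trans[rotated]) (intro emeasure_mono, auto)
    ultimately have "shift_L1 S F' z \<le> ennreal (2 * (h powr s * (l + 1)))"
      unfolding shift_L1_def
      using l h by (intro nn_integral_le_of_Lp_norm[OF _ _ _ AE_shift_difference[OF S(1) eq] q]) auto
    also have "2 * (h powr s * (l + 1)) = 2 * (l + 1) * 2 powr s * norm z powr s"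
      by (simp add: h_def powr_mult)
    finally show ?thesis .
  qed
  show thesis by (rule that[OF _ sh]) (use l in auto)
qed

text \<open>Translating by \<open>z\<close> interchanges the two points that are compared.
  \<open>BV_space\<close> speaks of steps \<open>h > 0\<close> only, and this covers the negative
  ones.\<close>

lemma shift_L1_minus:
  fixes F :: "'a::euclidean_space \<Rightarrow> real"
  assumes [measurable]: "S \<in> sets borel" "F \<in> borel_measurable borel"
  shows "shift_L1 S F (- z) = shift_L1 S F z"
proof -
  have "shift_L1 S F (- z) = (\<integral>\<^sup>+x. ennreal \<bar>F (z + x + - z) - F (z + x)\<bar> * indicator {x. x \<in> S \<and> x + - z \<in> S} (z + x) \<partial>lborel)"
    unfolding shift_L1_def by (rule nn_integral_lborel_shift) measurable
  also have "\<dots> = shift_L1 S F z"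
    unfolding shift_L1_def
    by (intro nn_integral_cong) (auto simp: indicator_def abs_minus_commute add.commute)
  finally show ?thesis .
qed

lemma BV_space_shift_L1_Basis:
  fixes F F' :: "'a::euclidean_space \<Rightarrow> real"
  assumes S: "S \<in> sets borel"
    and F': "F' \<in> borel_measurable borel" and eq: "AE x in lebesgue_on S. F x = F' x"
    and F: "F \<in> BV_space S"
  obtains C where "C \<ge> 0" "\<And>t e. e \<in> Basis \<Longrightarrow> shift_L1 S F' (t *\<^sub>R e) \<le> ennreal (C * \<bar>t\<bar>)"
proof -
  note [measurable] = S F'
  define V where "V h = (\<Sum>e\<in>Basis. \<integral>\<^sup>+x. ennreal \<bar>F (x + h *\<^sub>R e) - F x\<bar>
                         \<partial>lebesgue_on {x. x \<in> S \<and> x + h *\<^sub>R e \<in> S})" for h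
  define L where "L = (SUP h\<in>{0<..}. ennreal (1 / h) * V h)"
  have "L < \<infinity>" using F by (simp add: BV_space_def L_def V_def)
  then obtain l where l: "L = ennreal l" "l \<ge> 0" by (cases L) auto
  have pos: "shift_L1 S F' (h *\<^sub>R e) \<le> ennreal (l * h)" if h: "h > 0" and e: "e \<in> Basis" for h e
  proof -
    have "ennreal (1 / h) * V h \<le> ennreal l"
      unfolding l(1)[symmetric] L_def using h by (intro SUP_upper) auto
    then have "ennreal h * (ennreal (1 / h) * V h) \<le> ennreal h * ennreal l"
      by (intro mult_left_mono) auto
    then have "V h \<le> ennreal (l * h)"
      using h l by (simp add: mult.assoc[symmetric] ennreal_mult'[symmetric] mult.commute)
    moreover have "shift_L1 S F' (h *\<^sub>R e) = (\<integral>\<^sup>+x. ennreal \<bar>F (x + h *\<^sub>R e) - F x\<bar>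
                         \<partial>lebesgue_on {x. x \<in> S \<and> x + h *\<^sub>R e \<in> S})"
      unfolding shift_L1_def nn_integral_lebesgue_on_eq[OF shift_set_measurable[OF S], symmetric]
      by (intro nn_integral_cong_AE)
         (use AE_shift_difference[OF S eq, of "h *\<^sub>R e"] in \<open>auto elim: eventually_mono\<close>)
    moreover have "\<dots> \<le> V h"
      unfolding V_def using e by (intro member_le_sum) auto
    ultimately show ?thesis by simp
  qed
  have "shift_L1 S F' (t *\<^sub>R e) \<le> ennreal (l * \<bar>t\<bar>)" if e: "e \<in> Basis" for t e
  proof (cases "t = 0")
    case True
    then show ?thesis by (simp add: shift_L1_def)
  next
    case False
    then have "shift_L1 S F' (t *\<^sub>R e) = shift_L1 S F' (\<bar>t\<bar> *\<^sub>R e)"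
      using shift_L1_minus[OF S F', of "t *\<^sub>R e"] by (cases "t > 0") auto
    then show ?thesis using pos[of "\<bar>t\<bar>" e] e False by simp
  qed
  with l show thesis by (intro that)
qed

text \<open>The linear bound is written with \<open>powr 1\<close> so that BV functions meet the
  same interface as Lipschitz functions of order \<open>s\<close>.\<close>

lemma BV_space_shift_L1_real:
  fixes F F' :: "real \<Rightarrow> real"
  assumes "S \<in> sets borel" "F' \<in> borel_measurable borel" "AE x in lebesgue_on S. F x = F' x"
    and "F \<in> BV_space S"
  obtains C where "C \<ge> 0" "\<And>z. shift_L1 S F' z \<le> ennreal (C * norm z powr 1)"
proof -
  obtain C where C: "C \<ge> 0" "\<And>t e. e \<in> Basis \<Longrightarrow> shift_L1 S F' (t *\<^sub>R e) \<le> ennreal (C * \<bar>t\<bar>)"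
    using BV_space_shift_L1_Basis[OF assms] by blast
  have "shift_L1 S F' z \<le> ennreal (C * norm z powr 1)" for z
    using C(2)[of 1 z] by (cases "z = 0") (auto simp: shift_L1_def)
  with C show thesis by (intro that)
qed

text \<open>The triangle inequality through the intermediate point \<open>x + (a, 0)\<close>. Since
  the domain is a product, this point lies in it: its first coordinate is that of
  \<open>x + (a, b)\<close>, its second that of \<open>x\<close>. The second difference becomes a
  shift by \<open>(0, b)\<close> after a translation.\<close>

lemma shift_L1_Times_le:
  fixes F :: "'a::euclidean_space \<times> 'b::euclidean_space \<Rightarrow> real"
  assumes [measurable]: "A \<in> sets borel" "B \<in> sets borel" "F \<in> borel_measurable borel"
  shows "shift_L1 (A \<times> B) F (a, b) \<le> shift_L1 (A \<times> B) F (a, 0) + shift_L1 (A \<times> B) F (0, b)"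
proof -
  have [measurable]: "A \<times> B \<in> sets borel" by (rule borel_Times) auto
  let ?f = "\<lambda>z x. ennreal \<bar>F (x + z) - F x\<bar> * indicator {x. x \<in> A \<times> B \<and> x + z \<in> A \<times> B} x"
  have "shift_L1 (A \<times> B) F (a, b) \<le> (\<integral>\<^sup>+x. ?f (a, 0) x + ?f (0, b) ((a, 0) + x) \<partial>lborel)"
    unfolding shift_L1_def
  proof (intro nn_integral_mono)
    fix x :: "'a \<times> 'b"
    have "x + (a, b) = (a, 0) + x + (0, b)" by (cases x) simp
    moreover have "\<bar>F ((a, 0) + x + (0, b)) - F x\<bar>
        \<le> \<bar>F (x + (a, 0)) - F x\<bar> + \<bar>F ((a, 0) + x + (0, b)) - F ((a, 0) + x)\<bar>"
      by (simp add: add.commute)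
    then have "ennreal \<bar>F ((a, 0) + x + (0, b)) - F x\<bar>
        \<le> ennreal \<bar>F (x + (a, 0)) - F x\<bar> + ennreal \<bar>F ((a, 0) + x + (0, b)) - F ((a, 0) + x)\<bar>"
      by (simp add: ennreal_plus[symmetric] ennreal_leI del: ennreal_plus)
    moreover have "x + (a, 0) \<in> A \<times> B \<and> (a, 0) + x \<in> A \<times> B" if "x \<in> A \<times> B" "x + (a, b) \<in> A \<times> B"
      using that by (cases x) (auto simp: add.commute)
    ultimately show "?f (a, b) x \<le> ?f (a, 0) x + ?f (0, b) ((a, 0) + x)"
      by (auto simp: indicator_def add.commute)
  qed
  also have "\<dots> = (\<integral>\<^sup>+x. ?f (a, 0) x \<partial>lborel) + (\<integral>\<^sup>+x. ?f (0, b) ((a, 0) + x) \<partial>lborel)"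
    by (intro nn_integral_add) measurable
  also have "(\<integral>\<^sup>+x. ?f (0, b) ((a, 0) + x) \<partial>lborel) = (\<integral>\<^sup>+x. ?f (0, b) x \<partial>lborel)"
    by (rule nn_integral_lborel_shift[symmetric]) measurable
  finally show ?thesis by (simp add: shift_L1_def)
qed

text \<open>The two coordinate shifts have length at most \<open>norm z\<close> each, hence the
  constant \<open>2 * C\<close>.\<close>

lemma BV_space_shift_L1_Times:
  fixes F F' :: "real \<times> real \<Rightarrow> real"
  assumes AB: "A \<in> sets borel" "B \<in> sets borel" and F': "F' \<in> borel_measurable borel"
    and eq: "AE x in lebesgue_on (A \<times> B). F x = F' x" and F: "F \<in> BV_space (A \<times> B)"
  obtains C where "C \<ge> 0" "\<And>z. shift_L1 (A \<times> B) F' z \<le> ennreal (C * norm z powr 1)"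
proof -
  have S: "A \<times> B \<in> sets borel" using AB by (rule borel_Times)
  obtain C where C: "C \<ge> 0"
    "\<And>t e. e \<in> Basis \<Longrightarrow> shift_L1 (A \<times> B) F' (t *\<^sub>R e) \<le> ennreal (C * \<bar>t\<bar>)"
    using BV_space_shift_L1_Basis[OF S F' eq F] by blast
  have "shift_L1 (A \<times> B) F' z \<le> ennreal (2 * C * norm z powr 1)" for z
  proof -
    obtain a b where z: "z = (a, b)" by (cases z)
    have ab: "\<bar>a\<bar> \<le> norm z" "\<bar>b\<bar> \<le> norm z"
      using norm_fst_le[of a b] norm_snd_le[of b a] by (auto simp: z)
    have "shift_L1 (A \<times> B) F' z \<le> shift_L1 (A \<times> B) F' (a *\<^sub>R (1, 0)) + shift_L1 (A \<times> B) F' (b *\<^sub>R (0, 1))"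
      using shift_L1_Times_le[OF AB F', of a b] by (simp add: z)
    also have "\<dots> \<le> ennreal (C * \<bar>a\<bar>) + ennreal (C * \<bar>b\<bar>)"
      by (intro add_mono C(2)) (auto simp: Basis_prod_def)
    also have "\<dots> = ennreal (C * \<bar>a\<bar> + C * \<bar>b\<bar>)"
      using C(1) by simp
    also have "\<dots> \<le> ennreal (2 * C * norm z powr 1)"
    proof (intro ennreal_leI)
      show "C * \<bar>a\<bar> + C * \<bar>b\<bar> \<le> 2 * C * norm z powr 1"
        using mult_left_mono[OF ab(1) C(1)] mult_left_mono[OF ab(2) C(1)] by simp
    qed
    finally show ?thesis .
  qed
  with C(1) show thesis by (intro that[of "2 * C"]) auto
qed

section \<open>Averages over cells\<close>

lemma integral_lebesgue_on_eq:
  fixes f :: "'a::euclidean_space \<Rightarrow> real"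
  assumes "S \<in> sets borel" "f \<in> borel_measurable borel"
  shows "(LINT x|lebesgue_on S. f x) = (LINT x:S|lborel. f x)"
proof -
  have "(LINT x|lebesgue_on S. f x) = (LINT x|lebesgue. indicator S x *\<^sub>R f x)"
    using assms by (intro integral_restrict_space) auto
  also have "\<dots> = (LINT x:S|lborel. f x)"
    unfolding set_lebesgue_integral_def using assms by (intro integral_completion) simp
  finally show ?thesis .
qed

lemma integrable_lebesgue_on_eq:
  fixes f :: "'a::euclidean_space \<Rightarrow> real"
  assumes "S \<in> sets borel" "f \<in> borel_measurable borel"
  shows "integrable (lebesgue_on S) f \<longleftrightarrow> set_integrable lborel S f"
proof -
  have "integrable (lebesgue_on S) f \<longleftrightarrow> integrable lebesgue (\<lambda>x. indicator S x *\<^sub>R f x)"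
    using assms by (intro integrable_restrict_space) auto
  also have "\<dots> \<longleftrightarrow> set_integrable lborel S f"
    unfolding set_integrable_def using assms by (intro integrable_completion) simp
  finally show ?thesis .
qed

lemma integrable_lebesgue_on_bounded:
  fixes f :: "'a::euclidean_space \<Rightarrow> real"
  assumes "S \<in> lmeasurable" "f \<in> borel_measurable borel" "\<And>x. \<bar>f x\<bar> \<le> c"
  shows "integrable (lebesgue_on S) f"
proof -
  interpret finite_measure "lebesgue_on S" by (rule finite_measure_lebesgue_on[OF assms(1)])
  show ?thesis
    by (rule integrable_const_bound[of _ c]) (use assms borel_measurable_lebesgue_onI in auto)
qed

lemma cell_borel [measurable]: "cell n i \<in> sets borel"
  by (simp add: cell_def)

lemma cell_Times_borel [measurable]: "cell n i \<times> cell n j \<in> sets borel"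
  by (intro borel_Times cell_borel)

lemma emeasure_cell: "emeasure lborel (cell n i) = ennreal (1 / real n)"
proof -
  have "real i / real n - (real i - 1) / real n = 1 / real n"
    by (simp add: diff_divide_distrib)
  then show ?thesis unfolding cell_def by (subst emeasure_lborel_Ico) (auto simp: divide_right_mono)
qed

lemma emeasure_lborel_Times:
  fixes A :: "'a::euclidean_space set" and B :: "'b::euclidean_space set"
  assumes "A \<in> sets borel" "B \<in> sets borel"
  shows "emeasure lborel (A \<times> B) = emeasure lborel A * emeasure lborel B"
  unfolding lborel_prod[symmetric] using assms by (intro lborel.emeasure_pair_measure_Times) auto

lemma emeasure_cell_Times:
  "emeasure lborel (cell n i \<times> cell n j) = ennreal (1 / (real n)\<^sup>2)"
  by (simp add: emeasure_lborel_Times emeasure_cell ennreal_mult'[symmetric] power2_eq_square)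

lemma lmeasurable_borelI:
  fixes S :: "'a::euclidean_space set"
  assumes "S \<in> sets borel" "emeasure lborel S < \<infinity>"
  shows "S \<in> lmeasurable"
  using assms by (intro fmeasurableI) auto

lemma cell_lmeasurable: "cell n i \<in> lmeasurable" "cell n i \<times> cell n j \<in> lmeasurable"
  by (auto intro!: lmeasurable_borelI simp: emeasure_cell emeasure_cell_Times)

lemma mem_cell_iff:
  "n \<ge> 1 \<Longrightarrow> x \<in> cell n i \<longleftrightarrow> real i - 1 \<le> real n * x \<and> real n * x < real i"
  by (auto simp: cell_def field_simps)

lemma disjoint_cells: "n \<ge> 1 \<Longrightarrow> disjoint_family_on (cell n) I"
  by (auto simp: disjoint_family_on_def mem_cell_iff)

lemma disjoint_cells_Times:
  "n \<ge> 1 \<Longrightarrow> disjoint_family_on (\<lambda>(i, j). cell n i \<times> cell n j) I"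
  by (auto simp: disjoint_family_on_def mem_cell_iff)

lemma cell_subset_Omega:
  assumes "n \<ge> 1" "i \<in> {1..n}"
  shows "cell n i \<subseteq> Omega"
proof
  fix x assume "x \<in> cell n i"
  then have "real i - 1 \<le> real n * x" "real n * x < real i"
    using assms(1) by (simp_all add: mem_cell_iff)
  moreover have "1 \<le> real i" "real i \<le> real n" using assms(2) by auto
  ultimately have "0 \<le> real n * x" "real n * x \<le> real n * 1" by linarith+
  then show "x \<in> Omega"
    using assms(1) mult_le_cancel_left_pos[of "real n" x 1] by (simp add: Omega_def zero_le_mult_iff)
qed

lemma cell_diff:
  assumes "n \<ge> 1" "x \<in> cell n i" "y \<in> cell n i"
  shows "y - x \<in> {- 1 / real n..1 / real n}"
proof -
  have "real n * (y - x) \<le> 1" "- 1 \<le> real n * (y - x)"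
    using assms by (auto simp: mem_cell_iff algebra_simps)
  then show ?thesis using assms(1) by (simp add: field_simps)
qed

lemma Omega_borel [measurable]: "Omega \<in> sets borel" "Omega \<times> Omega \<in> sets borel"
  by (auto simp: Omega_def intro!: borel_Times)

lemma emeasure_Omega: "emeasure lborel Omega = 1" "emeasure lborel (Omega \<times> Omega) = 1"
proof -
  show "emeasure lborel Omega = 1" by (simp add: Omega_def)
  then show "emeasure lborel (Omega \<times> Omega) = 1" by (simp add: emeasure_lborel_Times)
qed

lemma Omega_lmeasurable: "Omega \<in> lmeasurable" "Omega \<times> Omega \<in> lmeasurable"
  by (auto intro!: lmeasurable_borelI simp: emeasure_Omega)

lemma ennreal_integral_deviation:
  fixes F :: "'a::euclidean_space \<Rightarrow> real"
  assumes [measurable]: "F \<in> borel_measurable borel" and Q: "Q \<in> lmeasurable" "Q \<in> sets borel"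
    and F: "\<And>x. \<bar>F x\<bar> \<le> c"
  shows "ennreal (LINT x|lebesgue_on Q. \<bar>F x - a\<bar>) = (\<integral>\<^sup>+x. ennreal \<bar>F x - a\<bar> * indicator Q x \<partial>lborel)"
proof -
  have "\<bar>F x - a\<bar> \<le> c + \<bar>a\<bar>" for x using F[of x] by linarith
  then have "integrable (lebesgue_on Q) (\<lambda>x. \<bar>F x - a\<bar>)"
    by (intro integrable_lebesgue_on_bounded[OF Q(1), of _ "c + \<bar>a\<bar>"]) auto
  then have "ennreal (LINT x|lebesgue_on Q. \<bar>F x - a\<bar>) = (\<integral>\<^sup>+x. ennreal \<bar>F x - a\<bar> \<partial>lebesgue_on Q)"
    by (intro nn_integral_eq_integral[symmetric]) auto
  then show ?thesis by (simp add: nn_integral_lebesgue_on_eq[OF Q(2)])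
qed

text \<open>Differences within a cell of length \<open>1 / n\<close> lie in an interval of length
  \<open>2 / n\<close>; the quotient of the lengths is the factor \<open>2\<close>.\<close>

lemma sum_deviation_discretize:
  assumes F[measurable]: "F \<in> borel_measurable borel" and bF: "\<And>x. \<bar>F x\<bar> \<le> c"
    and C: "C \<ge> 0" "\<And>z. shift_L1 Omega F z \<le> ennreal (C * norm z powr s)"
    and s: "s > 0" and n: "n \<ge> 1"
  shows "(\<Sum>i=1..n. LINT x|lebesgue_on (cell n i). \<bar>F x - discretize n F i\<bar>) \<le> 2 * C * real n powr (- s)"
proof -
  have np: "real n > 0" using n by simp
  have d: "discretize n F i = (LINT y:cell n i|lborel. F y) / (1 / real n)" for i
    by (simp add: discretize_def integral_lebesgue_on_eq)
  have "ennreal (\<Sum>i=1..n. LINT x|lebesgue_on (cell n i). \<bar>F x - discretize n F i\<bar>)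
      = (\<Sum>i=1..n. \<integral>\<^sup>+x. ennreal \<bar>F x - (LINT y:cell n i|lborel. F y) / (1 / real n)\<bar> * indicator (cell n i) x \<partial>lborel)"
    unfolding d[symmetric]
    by (subst sum_ennreal[symmetric]) (auto simp: ennreal_integral_deviation[OF F cell_lmeasurable(1) cell_borel bF])
  also have "\<dots> \<le> ennreal (1 / (1 / real n)) *
      (ennreal (C * (1 / real n) powr s) * emeasure lborel {- 1 / real n..1 / real n})"
  proof (rule sum_cells_mean_deviation[where S = Omega])
    show "set_integrable lborel (cell n i) F" for i
      using integrable_lebesgue_on_bounded[OF cell_lmeasurable(1) F bF]
      by (simp add: integrable_lebesgue_on_eq)
    show "shift_L1 Omega F z \<le> ennreal (C * (1 / real n) powr s)" if "z \<in> {- 1 / real n..1 / real n}" for z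
    proof -
      have "norm z \<le> 1 / real n" using that by (simp add: abs_le_iff)
      then have "C * norm z powr s \<le> C * (1 / real n) powr s"
        using s C(1) by (intro mult_left_mono powr_mono2) auto
      then show ?thesis using C(2)[of z] by (meson ennreal_leI order_trans)
    qed
    show "cell n i \<subseteq> Omega" if "i \<in> {1..n}" for i
      by (rule cell_subset_Omega[OF n that])
    show "y - x \<in> {- 1 / real n..1 / real n}" if "x \<in> cell n i" "y \<in> cell n i" for i x y
      by (rule cell_diff[OF n that])
  qed (use n in \<open>simp_all add: emeasure_cell disjoint_cells\<close>)
  also have "emeasure lborel {- 1 / real n..1 / real n} = ennreal (2 / real n)"
    by (subst emeasure_lborel_Icc) (auto simp: field_simps)
  also have "ennreal (1 / (1 / real n)) * (ennreal (C * (1 / real n) powr s) * ennreal (2 / real n))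
      = ennreal (real n * (C * (1 / real n) powr s * (2 / real n)))"
    using C(1) by (simp add: ennreal_mult'[symmetric])
  also have "real n * (C * (1 / real n) powr s * (2 / real n)) = 2 * C * real n powr (- s)"
    using np by (simp add: powr_divide powr_minus_divide)
  finally show ?thesis
    using C(1) by (subst (asm) ennreal_le_iff) auto
qed

text \<open>The factor \<open>4\<close> is the area of the square of differences divided by that of
  a product cell. The factor \<open>2 powr s\<close> comes from bounding the norm of a difference by
  the sum of its coordinates, at most \<open>2 / n\<close>.\<close>

lemma sum_deviation_discretize_kernel:
  assumes F[measurable]: "F \<in> borel_measurable borel" and bF: "\<And>x. \<bar>F x\<bar> \<le> c"
    and C: "C \<ge> 0" "\<And>z. shift_L1 (Omega \<times> Omega) F z \<le> ennreal (C * norm z powr s)"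
    and s: "s > 0" and n: "n \<ge> 1"
  shows "(\<Sum>i=1..n. \<Sum>j=1..n. LINT z|lebesgue_on (cell n i \<times> cell n j). \<bar>F z - discretize_kernel n F i j\<bar>)
    \<le> 4 * 2 powr s * C * real n powr (- s)"
proof -
  have np: "real n > 0" using n by simp
  let ?I = "{1..n} \<times> {1..n}" and ?Q = "\<lambda>(i, j). cell n i \<times> cell n j"
  let ?B = "{- 1 / real n..1 / real n}"
  have d: "discretize_kernel n F i j = (LINT y:?Q (i, j)|lborel. F y) / (1 / (real n)\<^sup>2)" for i j
    by (simp add: discretize_kernel_def integral_lebesgue_on_eq)
  have eq: "(\<Sum>i=1..n. \<Sum>j=1..n. LINT z|lebesgue_on (cell n i \<times> cell n j). \<bar>F z - discretize_kernel n F i j\<bar>)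
     = (\<Sum>k\<in>?I. LINT z|lebesgue_on (?Q k). \<bar>F z - (LINT y:?Q k|lborel. F y) / (1 / (real n)\<^sup>2)\<bar>)"
    unfolding sum.cartesian_product d by (intro sum.cong refl) clarsimp
  have "ennreal (\<Sum>k\<in>?I. LINT z|lebesgue_on (?Q k). \<bar>F z - (LINT y:?Q k|lborel. F y) / (1 / (real n)\<^sup>2)\<bar>)
      = (\<Sum>k\<in>?I. ennreal (LINT z|lebesgue_on (?Q k). \<bar>F z - (LINT y:?Q k|lborel. F y) / (1 / (real n)\<^sup>2)\<bar>))"
    by (rule sum_ennreal[symmetric]) (rule Bochner_Integration.integral_nonneg, rule abs_ge_zero)
  also have "\<dots> = (\<Sum>k\<in>?I. \<integral>\<^sup>+x. ennreal \<bar>F x - (LINT y:?Q k|lborel. F y) / (1 / (real n)\<^sup>2)\<bar> * indicator (?Q k) x \<partial>lborel)"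
  proof (rule sum.cong[OF refl])
    fix k
    have "?Q k \<in> lmeasurable" "?Q k \<in> sets borel"
      by (cases k; simp add: cell_lmeasurable)+
    then show "ennreal (LINT z|lebesgue_on (?Q k). \<bar>F z - (LINT y:?Q k|lborel. F y) / (1 / (real n)\<^sup>2)\<bar>)
      = (\<integral>\<^sup>+x. ennreal \<bar>F x - (LINT y:?Q k|lborel. F y) / (1 / (real n)\<^sup>2)\<bar> * indicator (?Q k) x \<partial>lborel)"
      by (rule ennreal_integral_deviation[OF F _ _ bF])
  qed
  also have "\<dots> \<le> ennreal (1 / (1 / (real n)\<^sup>2)) *
      (ennreal (C * (2 / real n) powr s) * emeasure lborel (?B \<times> ?B))"
  proof (rule sum_cells_mean_deviation[where S = "Omega \<times> Omega"])
    show "set_integrable lborel (?Q k) F" for k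
      using integrable_lebesgue_on_bounded[OF cell_lmeasurable(2) F bF]
      by (cases k) (simp add: integrable_lebesgue_on_eq)
    show "shift_L1 (Omega \<times> Omega) F z \<le> ennreal (C * (2 / real n) powr s)" if "z \<in> ?B \<times> ?B" for z
    proof -
      obtain a b where z: "z = (a, b)" by (cases z)
      have "norm z \<le> \<bar>a\<bar> + \<bar>b\<bar>" unfolding z using norm_Pair_le[of a b] by simp
      moreover have "\<bar>a\<bar> \<le> 1 / real n" "\<bar>b\<bar> \<le> 1 / real n" using that z by (auto simp: abs_le_iff)
      ultimately have "norm z \<le> 2 / real n" by (simp add: field_simps)
      then have "C * norm z powr s \<le> C * (2 / real n) powr s"
        using s C(1) by (intro mult_left_mono powr_mono2) auto
      then show ?thesis using C(2)[of z] by (meson ennreal_leI order_trans)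
    qed
    show "disjoint_family_on ?Q ?I" by (rule disjoint_cells_Times[OF n])
    show "y - x \<in> ?B \<times> ?B" if "k \<in> ?I" "x \<in> ?Q k" "y \<in> ?Q k" for k x y
      using that cell_diff[OF n] by (cases k, cases x, cases y) auto
    show "?B \<times> ?B \<in> sets borel" by (intro borel_Times) auto
    show "?Q k \<subseteq> Omega \<times> Omega" if "k \<in> ?I" for k
      using that cell_subset_Omega[OF n] by (cases k) (auto dest!: subsetD)
  qed (use n in \<open>auto simp: emeasure_cell_Times\<close>)
  also have "emeasure lborel (?B \<times> ?B) = ennreal (2 / real n * (2 / real n))"
  proof -
    have "emeasure lborel ?B = ennreal (2 / real n)"
      by (subst emeasure_lborel_Icc) (auto simp: field_simps)
    moreover have "emeasure lborel (?B \<times> ?B) = emeasure lborel ?B * emeasure lborel ?B"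
      by (rule emeasure_lborel_Times) auto
    ultimately show ?thesis by (simp only: ennreal_mult'[symmetric] divide_nonneg_nonneg of_nat_0_le_iff zero_le_numeral)
  qed
  also have "ennreal (1 / (1 / (real n)\<^sup>2)) * (ennreal (C * (2 / real n) powr s) * ennreal (2 / real n * (2 / real n)))
      = ennreal ((real n)\<^sup>2 * (C * (2 / real n) powr s * (2 / real n * (2 / real n))))"
    using C(1) by (simp add: ennreal_mult'[symmetric])
  also have "(real n)\<^sup>2 * (C * (2 / real n) powr s * (2 / real n * (2 / real n))) = 4 * 2 powr s * C * real n powr (- s)"
    using np by (simp add: powr_divide powr_minus_divide power2_eq_square)
  finally show ?thesis
    unfolding eq using C(1) by (subst (asm) ennreal_le_iff) auto
qed

text \<open>The sets \<open>Q i\<close> may miss part of \<open>S\<close>, but equality of the total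
  measures makes the rest null. For the half-open cells the rest is the point \<open>1\<close>, and
  in the square the two edges through \<open>(1, 1)\<close>.\<close>

lemma integral_lebesgue_on_partition:
  fixes f :: "'a::euclidean_space \<Rightarrow> real" and Q :: "'i \<Rightarrow> 'a set"
  assumes I: "finite I" "disjoint_family_on Q I"
    and Q: "\<And>i. i \<in> I \<Longrightarrow> Q i \<in> sets borel" "\<And>i. i \<in> I \<Longrightarrow> Q i \<subseteq> S"
    and S: "S \<in> sets borel" "emeasure lborel S < \<infinity>"
    and sum: "emeasure lborel S = (\<Sum>i\<in>I. emeasure lborel (Q i))"
    and f[measurable]: "f \<in> borel_measurable borel" and int: "integrable (lebesgue_on S) f"
  shows "(LINT x|lebesgue_on S. f x) = (\<Sum>i\<in>I. LINT x|lebesgue_on (Q i). f x)"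
proof -
  let ?U = "\<Union>i\<in>I. Q i"
  have U: "?U \<in> sets borel" using I Q by auto
  note [measurable] = U S(1)
  have "emeasure lborel ?U = emeasure lborel S"
    unfolding sum using I Q by (intro sum_emeasure[symmetric]) auto
  moreover have "?U \<subseteq> S" using Q by auto
  ultimately have "emeasure lborel (S - ?U) = 0"
    using S by (subst emeasure_Diff) auto
  then have "S - ?U \<in> null_sets lborel" by (intro null_setsI) auto
  then have AE: "AE x in lborel. x \<in> S \<longleftrightarrow> x \<in> ?U"
    using AE_not_in[of "S - ?U" lborel] \<open>?U \<subseteq> S\<close> by (auto elim!: eventually_mono)
  have iS: "set_integrable lborel S f"
    using int S f by (simp add: integrable_lebesgue_on_eq)
  have "(LINT x|lebesgue_on S. f x) = (LINT x:S|lborel. f x)"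
    using S f by (simp add: integral_lebesgue_on_eq)
  also have "\<dots> = (LINT x:?U|lborel. f x)"
    unfolding set_lebesgue_integral_def
  proof (rule integral_cong_AE)
    show "AE x in lborel. indicat_real S x *\<^sub>R f x = indicat_real ?U x *\<^sub>R f x"
      using AE by eventually_elim (auto simp: indicator_def)
  qed measurable
  also have "\<dots> = (\<Sum>i\<in>I. LINT x:Q i|lborel. f x)"
  proof (rule set_integral_finite_Union[OF I])
    show "set_integrable lborel (Q i) f" if "i \<in> I" for i
      using that Q by (intro set_integrable_subset[OF iS]) auto
  qed (use Q in auto)
  also have "\<dots> = (\<Sum>i\<in>I. LINT x|lebesgue_on (Q i). f x)"
    using Q f by (intro sum.cong) (auto simp: integral_lebesgue_on_eq)
  finally show ?thesis .
qed

lemma integral_Omega_cells: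
  fixes f :: "real \<Rightarrow> real"
  assumes n: "n \<ge> 1" and f: "f \<in> borel_measurable borel" "integrable (lebesgue_on Omega) f"
  shows "(LINT x|lebesgue_on Omega. f x) = (\<Sum>i=1..n. LINT x|lebesgue_on (cell n i). f x)"
proof (rule integral_lebesgue_on_partition[OF _ disjoint_cells[OF n]])
  show "emeasure lborel Omega = (\<Sum>i=1..n. emeasure lborel (cell n i))"
    using n by (simp add: emeasure_cell emeasure_Omega ennreal_of_nat_eq_real_of_nat ennreal_mult'[symmetric])
  show "cell n i \<subseteq> Omega" if "i \<in> {1..n}" for i
    by (rule cell_subset_Omega[OF n that])
qed (use f in \<open>simp_all add: emeasure_Omega\<close>)

lemma integral_Omega_Times_cells:
  fixes f :: "real \<times> real \<Rightarrow> real"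
  assumes n: "n \<ge> 1" and f: "f \<in> borel_measurable borel" "integrable (lebesgue_on (Omega \<times> Omega)) f"
  shows "(LINT z|lebesgue_on (Omega \<times> Omega). f z)
    = (\<Sum>i=1..n. \<Sum>j=1..n. LINT z|lebesgue_on (cell n i \<times> cell n j). f z)"
proof -
  let ?Q = "\<lambda>(i, j). cell n i \<times> cell n j"
  have e: "emeasure lborel (?Q k) = ennreal (1 / (real n)\<^sup>2)" for k
    by (cases k) (simp add: emeasure_cell_Times)
  have "(LINT z|lebesgue_on (Omega \<times> Omega). f z)
    = (\<Sum>k\<in>{1..n} \<times> {1..n}. LINT z|lebesgue_on (?Q k). f z)"
  proof (rule integral_lebesgue_on_partition[OF _ disjoint_cells_Times[OF n]])
    show "emeasure lborel (Omega \<times> Omega) = (\<Sum>k\<in>{1..n} \<times> {1..n}. emeasure lborel (?Q k))"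
      unfolding e using n
      by (simp add: emeasure_Omega ennreal_of_nat_eq_real_of_nat ennreal_mult'[symmetric] power2_eq_square)
    show "?Q k \<subseteq> Omega \<times> Omega" if "k \<in> {1..n} \<times> {1..n}" for k
      using that cell_subset_Omega[OF n] by (cases k) (auto dest!: subsetD)
    show "?Q k \<in> sets borel" for k
      by (cases k) simp
  qed (use f in \<open>simp_all add: emeasure_Omega\<close>)
  also have "\<dots> = (\<Sum>i=1..n. \<Sum>j=1..n. LINT z|lebesgue_on (cell n i \<times> cell n j). f z)"
    unfolding sum.cartesian_product by (intro sum.cong refl) clarsimp
  finally show ?thesis .
qed

lemma measurable_fst_snd_borel [measurable]:
  "fst \<in> borel \<rightarrow>\<^sub>M (borel :: 'a::euclidean_space measure)"
  "snd \<in> borel \<rightarrow>\<^sub>M (borel :: 'b::euclidean_space measure)"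
  by (auto intro!: borel_measurable_continuous_onI continuous_intros)

text \<open>Fubini for a function of one coordinate. It serves to identify the mean of
  \<open>u y - u x\<close> over a product of cells with a difference of two cell means.\<close>

lemma integral_Times_fst_snd:
  fixes f :: "real \<Rightarrow> real"
  assumes AB: "A \<in> sets borel" "B \<in> sets borel" "emeasure lborel A < \<infinity>" "emeasure lborel B < \<infinity>"
    and f[measurable]: "f \<in> borel_measurable borel" and bf: "\<And>x. \<bar>f x\<bar> \<le> c"
  shows "(LINT z|lebesgue_on (A \<times> B). f (fst z)) = measure lborel B * (LINT x|lebesgue_on A. f x)"
    and "(LINT z|lebesgue_on (A \<times> B). f (snd z)) = measure lborel A * (LINT x|lebesgue_on B. f x)"
proof -
  note [measurable] = AB(1,2)
  have AxB[measurable]: "A \<times> B \<in> sets borel" using AB by (intro borel_Times)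
  have "A \<times> B \<in> lmeasurable"
    using AB by (intro lmeasurable_borelI) (auto simp: emeasure_lborel_Times ennreal_mult_less_top)
  note bd = integrable_lebesgue_on_bounded[OF this, of _ c]
  have "integrable (lebesgue_on (A \<times> B)) (\<lambda>z. f (fst z))"
    by (rule bd) (simp_all add: bf)
  moreover have "integrable (lebesgue_on (A \<times> B)) (\<lambda>z. f (snd z))"
    by (rule bd) (simp_all add: bf)
  ultimately have int: "set_integrable lborel (A \<times> B) (\<lambda>z. f (fst z))" "set_integrable lborel (A \<times> B) (\<lambda>z. f (snd z))"
    by (simp_all add: integrable_lebesgue_on_eq)
  have "(LINT z|lebesgue_on (A \<times> B). f (fst z)) = (LINT z|(lborel \<Otimes>\<^sub>M lborel). indicator (A \<times> B) z *\<^sub>R f (fst z))"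
    by (simp add: integral_lebesgue_on_eq set_lebesgue_integral_def lborel_prod)
  also have "\<dots> = (LINT x|lborel. LINT y|lborel. indicator (A \<times> B) (x, y) *\<^sub>R f (fst (x, y)))"
    using int(1) unfolding set_integrable_def lborel_prod[symmetric]
    by (rule lborel_pair.integral_fst'[symmetric])
  also have "\<dots> = (LINT x|lborel. LINT y|lborel. (indicator A x * f x) * indicator B y)"
    by (simp add: indicator_times mult_ac)
  finally show "(LINT z|lebesgue_on (A \<times> B). f (fst z)) = measure lborel B * (LINT x|lebesgue_on A. f x)"
    using AB by (simp add: integral_lebesgue_on_eq set_lebesgue_integral_def mult.commute)
  have "(LINT z|lebesgue_on (A \<times> B). f (snd z)) = (LINT z|(lborel \<Otimes>\<^sub>M lborel). indicator (A \<times> B) z *\<^sub>R f (snd z))"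
    by (simp add: integral_lebesgue_on_eq set_lebesgue_integral_def lborel_prod)
  also have "\<dots> = (LINT x|lborel. LINT y|lborel. indicator (A \<times> B) (x, y) *\<^sub>R f (snd (x, y)))"
    using int(2) unfolding set_integrable_def lborel_prod[symmetric]
    by (rule lborel_pair.integral_fst'[symmetric])
  also have "\<dots> = (LINT x|lborel. LINT y|lborel. indicator A x * (indicator B y * f y))"
    by (simp add: indicator_times mult_ac)
  finally show "(LINT z|lebesgue_on (A \<times> B). f (snd z)) = measure lborel A * (LINT x|lebesgue_on B. f x)"
    using AB by (simp add: integral_lebesgue_on_eq set_lebesgue_integral_def mult.commute)
qed

section \<open>The energy as a real number\<close>

text \<open>Strong convexity and the comparison of energies use subtraction, which is awkward in
  \<open>ereal\<close>. The value agrees with \<open>energy\<close> for measurable data as soon as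
  the regularization integrand is integrable; otherwise the integral here defaults to
  \<open>0\<close>, whereas \<open>energy\<close> is infinite.\<close>

definition real_energy ::
    "real \<Rightarrow> real \<Rightarrow> (real \<Rightarrow> real) \<Rightarrow> (real \<times> real \<Rightarrow> real) \<Rightarrow> (real \<Rightarrow> real) \<Rightarrow> real" where
  "real_energy lam p g K v =
     1 / (2 * lam) * (LINT x|lebesgue_on Omega. (v x - g x)\<^sup>2)
     + 1 / (2 * p) * (LINT z|lebesgue_on (Omega \<times> Omega). K z * \<bar>v (snd z) - v (fst z)\<bar> powr p)"

text \<open>True also when \<open>F\<close> is not square integrable: \<open>enn2real\<close> sends
  the infinite norm to \<open>0\<close>, and the Bochner integral of a nonintegrable function is
  \<open>0\<close> as well.\<close>

lemma L2_norm_square: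
  assumes [measurable]: "F \<in> borel_measurable (lebesgue_on Omega)"
  shows "(L2_norm F)\<^sup>2 = (LINT x|lebesgue_on Omega. (F x)\<^sup>2)"
proof -
  define I where "I = (\<integral>\<^sup>+x. ennreal ((F x)\<^sup>2) \<partial>lebesgue_on Omega)"
  have "(\<integral>\<^sup>+x. ennreal (\<bar>F x\<bar> powr 2) \<partial>lebesgue_on Omega) = I"
    unfolding I_def by (intro nn_integral_cong) (simp add: powr_numeral)
  then have "L2_norm F = enn2real I powr (1 / 2)"
    by (auto simp: L2_norm_def Lp_norm_def Let_def)
  then have "(L2_norm F)\<^sup>2 = enn2real I"
    by (simp add: powr_half_sqrt)
  also have "\<dots> = (LINT x|lebesgue_on Omega. (F x)\<^sup>2)"
    unfolding I_def by (rule integral_eq_nn_integral[symmetric]) auto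
  finally show ?thesis .
qed

lemma energy_eq_real_energy:
  assumes "v \<in> borel_measurable (lebesgue_on Omega)" "g \<in> borel_measurable (lebesgue_on Omega)"
    and "integrable (lebesgue_on (Omega \<times> Omega)) (\<lambda>z. K z * \<bar>v (snd z) - v (fst z)\<bar> powr p)"
  shows "energy lam p g K v = ereal (real_energy lam p g K v)"
  using assms by (simp add: energy_def nonlocal_reg_def real_energy_def L2_norm_square case_prod_unfold)

lemma integrable_kernel_powr:
  fixes w :: "real \<times> real \<Rightarrow> real"
  assumes [measurable]: "K \<in> borel_measurable borel" "w \<in> borel_measurable borel"
    and K: "\<And>z. \<bar>K z\<bar> \<le> kb" and w: "\<And>z. \<bar>w z\<bar> \<le> c" and p: "p \<ge> 0"
    and S: "S \<in> lmeasurable"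
  shows "integrable (lebesgue_on S) (\<lambda>z. K z * \<bar>w z\<bar> powr p)"
proof (rule integrable_lebesgue_on_bounded[OF S, of _ "kb * c powr p"])
  fix z
  have "\<bar>w z\<bar> powr p \<le> c powr p" using w[of z] p by (intro powr_mono2) auto
  then show "\<bar>K z * \<bar>w z\<bar> powr p\<bar> \<le> kb * c powr p"
    unfolding abs_mult using K[of z] by (intro mult_mono) auto
qed measurable

section \<open>Energies of bounded functions\<close>

lemma measure_lebesgue_on_space:
  fixes S :: "'a::euclidean_space set"
  assumes "S \<in> sets borel"
  shows "measure (lebesgue_on S) (space (lebesgue_on S)) = measure lborel S"
  using assms by (simp add: measure_restrict_space)

lemma measure_cell: "measure lborel (cell n i) = 1 / real n"
  "measure lborel (cell n i \<times> cell n j) = 1 / (real n)\<^sup>2"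
  by (simp_all add: measure_def emeasure_cell emeasure_cell_Times)

lemma interpolate_cell:
  assumes "n \<ge> 1" "i \<in> {1..n}" "x \<in> cell n i"
  shows "interpolate n v x = v i"
proof -
  have "interpolate n v x = (\<Sum>j=1..n. if j = i then v i else 0)"
    unfolding interpolate_def using assms by (intro sum.cong) (auto simp: indicator_def mem_cell_iff)
  then show ?thesis using assms by simp
qed

lemma interpolate_measurable [measurable]: "interpolate n v \<in> borel_measurable borel"
  unfolding interpolate_def[abs_def] by measurable

lemma interpolate_bounded: "\<bar>interpolate n v x\<bar> \<le> (\<Sum>i=1..n. \<bar>v i\<bar>)"
  unfolding interpolate_def
  by (rule order_trans[OF sum_abs]) (intro sum_mono, auto simp: indicator_def)

lemma interpolate_cong: "(\<And>i. i \<in> {1..n} \<Longrightarrow> v i = w i) \<Longrightarrow> interpolate n v = interpolate n w"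
  by (intro ext) (simp add: interpolate_def)

lemma abs_discretize_le:
  assumes n: "n \<ge> 1" and f: "f \<in> borel_measurable borel" "\<And>x. \<bar>f x\<bar> \<le> c"
  shows "\<bar>discretize n f i\<bar> \<le> c"
proof -
  interpret finite_measure "lebesgue_on (cell n i)"
    by (rule finite_measure_lebesgue_on[OF cell_lmeasurable(1)])
  have int: "integrable (lebesgue_on (cell n i)) f"
    by (rule integrable_lebesgue_on_bounded[OF cell_lmeasurable(1) f])
  have "\<bar>LINT x|lebesgue_on (cell n i). f x\<bar> \<le> (LINT x|lebesgue_on (cell n i). \<bar>f x\<bar>)"
    by (rule integral_abs_bound)
  also have "\<dots> \<le> (LINT x|lebesgue_on (cell n i). c)"
    using int f(2) by (intro integral_mono) auto
  also have "\<dots> = c / real n"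
    using measure_lebesgue_on_space[OF cell_borel, of n i] measure_cell(1)[of n i] by simp
  finally show ?thesis
    using n by (simp add: discretize_def abs_mult field_simps)
qed

text \<open>The data are Borel and bounded everywhere, not just almost everywhere on
  \<open>Omega\<close>. For a bounded Borel \<open>v\<close> all integrands of the energy are then
  bounded Borel functions, integrable over every set of finite measure.\<close>

locale bounded_problem =
  fixes lam p M kb :: real and g :: "real \<Rightarrow> real" and K :: "real \<times> real \<Rightarrow> real"
  assumes lam: "lam > 0" and p: "p \<ge> 1"
    and g_measurable [measurable]: "g \<in> borel_measurable borel" and g_bounded: "\<And>x. \<bar>g x\<bar> \<le> M"
    and K_measurable [measurable]: "K \<in> borel_measurable borel"
    and K_nonneg: "\<And>z. K z \<ge> 0" and K_bounded: "\<And>z. K z \<le> kb"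
begin

lemma integrable_fit:
  assumes [measurable]: "v \<in> borel_measurable borel" and v: "\<And>x. \<bar>v x\<bar> \<le> c" and S: "S \<in> lmeasurable"
  shows "integrable (lebesgue_on S) (\<lambda>x. (v x - g x)\<^sup>2)"
proof (rule integrable_lebesgue_on_bounded[OF S, of _ "(c + M)\<^sup>2"])
  fix x
  have "\<bar>v x - g x\<bar> \<le> c + M" using v[of x] g_bounded[of x] by linarith
  from power_mono[OF this abs_ge_zero, of 2] show "\<bar>(v x - g x)\<^sup>2\<bar> \<le> (c + M)\<^sup>2" by simp
qed measurable

lemma integrable_reg:
  assumes [measurable]: "v \<in> borel_measurable borel" and v: "\<And>x. \<bar>v x\<bar> \<le> c" and S: "S \<in> lmeasurable"
  shows "integrable (lebesgue_on S) (\<lambda>z. K z * \<bar>v (snd z) - v (fst z)\<bar> powr p)"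
proof (rule integrable_kernel_powr[where kb = kb and c = "2 * c"])
  show "\<bar>v (snd z) - v (fst z)\<bar> \<le> 2 * c" for z :: "real \<times> real"
    using v[of "snd z"] v[of "fst z"] by linarith
  show "\<bar>K z\<bar> \<le> kb" for z using K_nonneg[of z] K_bounded[of z] by simp
qed (use p S in simp_all)

text \<open>Strong convexity comes from the fidelity alone: the parallelogram identity leaves a gain
  of a quarter of the squared distance, and the weight \<open>1 / (2 * lam)\<close> turns it into
  \<open>1 / (8 * lam)\<close>. The regularization term is merely convex, as \<open>K\<close> is
  nonnegative.\<close>

lemma real_energy_midpoint:
  assumes [measurable]: "u \<in> borel_measurable borel" "v \<in> borel_measurable borel"
    and bu: "\<And>x. \<bar>u x\<bar> \<le> c" and bv: "\<And>x. \<bar>v x\<bar> \<le> c"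
  shows "real_energy lam p g K (\<lambda>x. (u x + v x) / 2)
    \<le> (real_energy lam p g K u + real_energy lam p g K v) / 2
      - 1 / (8 * lam) * (LINT x|lebesgue_on Omega. (u x - v x)\<^sup>2)"
proof -
  have bw: "\<bar>(u x + v x) / 2\<bar> \<le> c" for x
    using bu[of x] bv[of x] by (auto simp: abs_le_iff)
  have w[measurable]: "(\<lambda>x. (u x + v x) / 2) \<in> borel_measurable borel" by measurable
  have iuv: "integrable (lebesgue_on Omega) (\<lambda>x. (u x - v x)\<^sup>2)"
  proof (rule integrable_lebesgue_on_bounded[OF Omega_lmeasurable(1), of _ "(2 * c)\<^sup>2"])
    fix x
    have "\<bar>u x - v x\<bar> \<le> 2 * c" using bu[of x] bv[of x] by linarith
    from power_mono[OF this abs_ge_zero, of 2] show "\<bar>(u x - v x)\<^sup>2\<bar> \<le> (2 * c)\<^sup>2" by simp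
  qed measurable
  note i1 = integrable_fit[OF _ _ Omega_lmeasurable(1)]
  note i2 = integrable_reg[OF _ _ Omega_lmeasurable(2)]
  have "(LINT x|lebesgue_on Omega. ((u x + v x) / 2 - g x)\<^sup>2)
      = (LINT x|lebesgue_on Omega. (u x - g x)\<^sup>2 / 2 + (v x - g x)\<^sup>2 / 2 - (u x - v x)\<^sup>2 / 4)"
    by (intro Bochner_Integration.integral_cong) (auto simp: power2_eq_square field_simps)
  also have "\<dots> = (LINT x|lebesgue_on Omega. (u x - g x)\<^sup>2) / 2 + (LINT x|lebesgue_on Omega. (v x - g x)\<^sup>2) / 2
      - (LINT x|lebesgue_on Omega. (u x - v x)\<^sup>2) / 4"
    using i1[of u c] i1[of v c] iuv bu bv by simp
  finally have fit: "(LINT x|lebesgue_on Omega. ((u x + v x) / 2 - g x)\<^sup>2)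
    = (LINT x|lebesgue_on Omega. (u x - g x)\<^sup>2) / 2 + (LINT x|lebesgue_on Omega. (v x - g x)\<^sup>2) / 2
      - (LINT x|lebesgue_on Omega. (u x - v x)\<^sup>2) / 4" .
  have "(LINT z|lebesgue_on (Omega \<times> Omega). K z * \<bar>(u (snd z) + v (snd z)) / 2 - (u (fst z) + v (fst z)) / 2\<bar> powr p)
      \<le> (LINT z|lebesgue_on (Omega \<times> Omega). K z * \<bar>u (snd z) - u (fst z)\<bar> powr p / 2 + K z * \<bar>v (snd z) - v (fst z)\<bar> powr p / 2)"
  proof (intro integral_mono)
    show "integrable (lebesgue_on (Omega \<times> Omega)) (\<lambda>z. K z * \<bar>(u (snd z) + v (snd z)) / 2 - (u (fst z) + v (fst z)) / 2\<bar> powr p)"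
      by (rule i2[OF w bw])
    show "integrable (lebesgue_on (Omega \<times> Omega)) (\<lambda>z. K z * \<bar>u (snd z) - u (fst z)\<bar> powr p / 2 + K z * \<bar>v (snd z) - v (fst z)\<bar> powr p / 2)"
      using i2[of u c] i2[of v c] bu bv by simp
    fix z
    have "\<bar>(u (snd z) + v (snd z)) / 2 - (u (fst z) + v (fst z)) / 2\<bar>
        = \<bar>((u (snd z) - u (fst z)) + (v (snd z) - v (fst z))) / 2\<bar>"
      by (rule arg_cong[where f = abs]) (simp add: field_simps)
    then have "\<bar>(u (snd z) + v (snd z)) / 2 - (u (fst z) + v (fst z)) / 2\<bar> powr p
        \<le> (\<bar>u (snd z) - u (fst z)\<bar> powr p + \<bar>v (snd z) - v (fst z)\<bar> powr p) / 2"
      using abs_powr_midpoint[OF p] by metis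
    from mult_left_mono[OF this K_nonneg[of z]]
    show "K z * \<bar>(u (snd z) + v (snd z)) / 2 - (u (fst z) + v (fst z)) / 2\<bar> powr p
      \<le> K z * \<bar>u (snd z) - u (fst z)\<bar> powr p / 2 + K z * \<bar>v (snd z) - v (fst z)\<bar> powr p / 2"
      by (simp add: field_simps)
  qed
  also have "\<dots> = (LINT z|lebesgue_on (Omega \<times> Omega). K z * \<bar>u (snd z) - u (fst z)\<bar> powr p) / 2
     + (LINT z|lebesgue_on (Omega \<times> Omega). K z * \<bar>v (snd z) - v (fst z)\<bar> powr p) / 2"
    using i2[of u c] i2[of v c] bu bv by simp
  finally have "1 / (2 * p) * (LINT z|lebesgue_on (Omega \<times> Omega). K z * \<bar>(u (snd z) + v (snd z)) / 2 - (u (fst z) + v (fst z)) / 2\<bar> powr p)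
     \<le> 1 / (2 * p) * ((LINT z|lebesgue_on (Omega \<times> Omega). K z * \<bar>u (snd z) - u (fst z)\<bar> powr p) / 2
     + (LINT z|lebesgue_on (Omega \<times> Omega). K z * \<bar>v (snd z) - v (fst z)\<bar> powr p) / 2)"
    using p by (intro mult_left_mono) auto
  then show ?thesis
    unfolding real_energy_def fit by (simp add: algebra_simps)
qed

lemma real_energy_interpolate:
  assumes n: "n \<ge> 1"
  shows "real_energy lam p g K (interpolate n v)
    = discrete_energy n lam p (discretize n g) (discretize_kernel n K) v
      + 1 / (2 * lam) * (\<Sum>i=1..n. LINT x|lebesgue_on (cell n i). (g x - discretize n g i)\<^sup>2)"
proof -
  have np: "real n > 0" using n by simp
  note bI = interpolate_bounded[of n v]
  have "(LINT x|lebesgue_on Omega. (interpolate n v x - g x)\<^sup>2)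
      = (\<Sum>i=1..n. LINT x|lebesgue_on (cell n i). (interpolate n v x - g x)\<^sup>2)"
    by (rule integral_Omega_cells[OF n _ integrable_fit[OF _ bI Omega_lmeasurable(1)]]) simp_all
  also have "\<dots> = (\<Sum>i=1..n. (v i - discretize n g i)\<^sup>2 / real n
      + (LINT x|lebesgue_on (cell n i). (g x - discretize n g i)\<^sup>2))"
  proof (rule sum.cong[OF refl])
    fix i assume i: "i \<in> {1..n}"
    interpret finite_measure "lebesgue_on (cell n i)"
      by (rule finite_measure_lebesgue_on[OF cell_lmeasurable(1)])
    have m: "measure (lebesgue_on (cell n i)) (space (lebesgue_on (cell n i))) = 1 / real n"
      by (simp only: measure_lebesgue_on_space[OF cell_borel] measure_cell)
    have ig: "integrable (lebesgue_on (cell n i)) g"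
      by (rule integrable_lebesgue_on_bounded[OF cell_lmeasurable(1) _ g_bounded]) simp
    have ig2: "integrable (lebesgue_on (cell n i)) (\<lambda>x. (g x)\<^sup>2)"
      using integrable_fit[of "\<lambda>x. 0" 0, OF _ _ cell_lmeasurable(1)] by simp
    have "(LINT x|lebesgue_on (cell n i). (interpolate n v x - g x)\<^sup>2)
        = (LINT x|lebesgue_on (cell n i). (v i - g x)\<^sup>2)"
      by (intro Bochner_Integration.integral_cong) (auto simp: interpolate_cell[OF n i])
    also have "\<dots> = 1 / real n * (v i - (LINT x|lebesgue_on (cell n i). g x) / (1 / real n))\<^sup>2
        + (LINT x|lebesgue_on (cell n i). (g x - (LINT x|lebesgue_on (cell n i). g x) / (1 / real n))\<^sup>2)"
      using integral_square_about_mean[OF _ ig ig2, of "v i"] np unfolding m by simp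
    also have "(LINT x|lebesgue_on (cell n i). g x) / (1 / real n) = discretize n g i"
      by (simp add: discretize_def)
    finally show "(LINT x|lebesgue_on (cell n i). (interpolate n v x - g x)\<^sup>2)
      = (v i - discretize n g i)\<^sup>2 / real n + (LINT x|lebesgue_on (cell n i). (g x - discretize n g i)\<^sup>2)"
      by simp
  qed
  finally have fit: "(LINT x|lebesgue_on Omega. (interpolate n v x - g x)\<^sup>2)
    = (\<Sum>i=1..n. \<bar>v i - discretize n g i\<bar>\<^sup>2) / real n
      + (\<Sum>i=1..n. LINT x|lebesgue_on (cell n i). (g x - discretize n g i)\<^sup>2)"
    by (simp add: sum.distrib sum_divide_distrib)
  have "(LINT z|lebesgue_on (Omega \<times> Omega). K z * \<bar>interpolate n v (snd z) - interpolate n v (fst z)\<bar> powr p)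
      = (\<Sum>i=1..n. \<Sum>j=1..n. LINT z|lebesgue_on (cell n i \<times> cell n j).
           K z * \<bar>interpolate n v (snd z) - interpolate n v (fst z)\<bar> powr p)"
    by (rule integral_Omega_Times_cells[OF n _ integrable_reg[OF _ bI Omega_lmeasurable(2)]]) simp_all
  also have "\<dots> = (\<Sum>i=1..n. \<Sum>j=1..n. discretize_kernel n K i j * \<bar>v j - v i\<bar> powr p / (real n)\<^sup>2)"
  proof (intro sum.cong refl)
    fix i j assume ij: "i \<in> {1..n}" "j \<in> {1..n}"
    have "(LINT z|lebesgue_on (cell n i \<times> cell n j). K z * \<bar>interpolate n v (snd z) - interpolate n v (fst z)\<bar> powr p)
      = (LINT z|lebesgue_on (cell n i \<times> cell n j). K z * \<bar>v j - v i\<bar> powr p)"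
      by (intro Bochner_Integration.integral_cong)
         (auto simp: interpolate_cell[OF n ij(1)] interpolate_cell[OF n ij(2)])
    then show "(LINT z|lebesgue_on (cell n i \<times> cell n j). K z * \<bar>interpolate n v (snd z) - interpolate n v (fst z)\<bar> powr p)
      = discretize_kernel n K i j * \<bar>v j - v i\<bar> powr p / (real n)\<^sup>2"
      using np by (simp add: discretize_kernel_def)
  qed
  also have "\<dots> = (\<Sum>i=1..n. \<Sum>j=1..n. discretize_kernel n K i j * \<bar>v j - v i\<bar> powr p) / (real n)\<^sup>2"
    by (simp add: sum_divide_distrib)
  finally have reg: "(LINT z|lebesgue_on (Omega \<times> Omega). K z * \<bar>interpolate n v (snd z) - interpolate n v (fst z)\<bar> powr p)
    = (\<Sum>i=1..n. \<Sum>j=1..n. discretize_kernel n K i j * \<bar>v j - v i\<bar> powr p) / (real n)\<^sup>2" .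
  show ?thesis
    unfolding real_energy_def fit reg discrete_energy_def by (simp add: algebra_simps)
qed

lemma discretize_kernel_bounds:
  assumes n: "n \<ge> 1"
  shows "0 \<le> discretize_kernel n K i j" "discretize_kernel n K i j \<le> kb"
proof -
  show "0 \<le> discretize_kernel n K i j"
    unfolding discretize_kernel_def by (intro mult_nonneg_nonneg Bochner_Integration.integral_nonneg K_nonneg) simp
  interpret finite_measure "lebesgue_on (cell n i \<times> cell n j)"
    by (rule finite_measure_lebesgue_on[OF cell_lmeasurable(2)])
  have "integrable (lebesgue_on (cell n i \<times> cell n j)) K"
    by (rule integrable_lebesgue_on_bounded[OF cell_lmeasurable(2), of _ kb])
       (use K_nonneg K_bounded in \<open>simp_all add: abs_of_nonneg\<close>)
  then have "(LINT z|lebesgue_on (cell n i \<times> cell n j). K z) \<le> (LINT z|lebesgue_on (cell n i \<times> cell n j). kb)"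
    using K_bounded by (intro integral_mono) auto
  also have "\<dots> = kb / (real n)\<^sup>2"
    using measure_lebesgue_on_space[OF cell_Times_borel, of n i j] measure_cell(2)[of n i j] by simp
  finally show "discretize_kernel n K i j \<le> kb"
    using n by (simp add: discretize_kernel_def field_simps)
qed

text \<open>Averaging does not increase the fidelity between \<open>u\<close> and \<open>g\<close>;
  what remains is the variance of \<open>g\<close> within cells, at most \<open>2 * M\<close> times
  its L1 deviation. In the regularizer, Jensen produces the averaged kernel in front of
  \<open>\<bar>u y - u x\<bar> powr p\<close>; restoring \<open>K\<close> costs at most
  \<open>(2 * M) powr p\<close> times the kernel deviation. The weights \<open>1 / (2 * lam)\<close>
  and \<open>1 / (2 * p)\<close> account for the constants.\<close>

lemma real_energy_interpolate_discretize_le: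
  assumes n: "n \<ge> 1" and u[measurable]: "u \<in> borel_measurable borel" and bu: "\<And>x. \<bar>u x\<bar> \<le> M"
  shows "real_energy lam p g K (interpolate n (discretize n u)) \<le> real_energy lam p g K u
    + M / lam * (\<Sum>i=1..n. LINT x|lebesgue_on (cell n i). \<bar>g x - discretize n g i\<bar>)
    + (2 * M) powr p / (2 * p) * (\<Sum>i=1..n. \<Sum>j=1..n.
        LINT z|lebesgue_on (cell n i \<times> cell n j). \<bar>K z - discretize_kernel n K i j\<bar>)"
proof -
  have np: "real n > 0" using n by simp
  let ?v = "discretize n u"
  have fit1: "(\<Sum>i=1..n. \<bar>?v i - discretize n g i\<bar>\<^sup>2) / real n \<le> (LINT x|lebesgue_on Omega. (u x - g x)\<^sup>2)"
  proof -
    have "\<bar>?v i - discretize n g i\<bar>\<^sup>2 / real n \<le> (LINT x|lebesgue_on (cell n i). (u x - g x)\<^sup>2)" for i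
    proof -
      interpret finite_measure "lebesgue_on (cell n i)"
        by (rule finite_measure_lebesgue_on[OF cell_lmeasurable(1)])
      have m: "measure (lebesgue_on (cell n i)) (space (lebesgue_on (cell n i))) = 1 / real n"
        by (simp only: measure_lebesgue_on_space[OF cell_borel] measure_cell)
      have int: "integrable (lebesgue_on (cell n i)) u" "integrable (lebesgue_on (cell n i)) g"
        by (rule integrable_lebesgue_on_bounded[OF cell_lmeasurable(1) _ bu], simp)
           (rule integrable_lebesgue_on_bounded[OF cell_lmeasurable(1) _ g_bounded], simp)
      have d: "(LINT x|lebesgue_on (cell n i). u x - g x) / (1 / real n) = ?v i - discretize n g i"
        using int by (simp add: discretize_def algebra_simps)
      \<comment> \<open>The variance identity for \<open>u - g\<close> about \<open>0\<close>, with
        the nonnegative variance discarded.\<close>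
      have "(LINT x|lebesgue_on (cell n i). (0 - (u x - g x))\<^sup>2)
          \<ge> 1 / real n * (0 - (LINT x|lebesgue_on (cell n i). u x - g x) / (1 / real n))\<^sup>2"
        using integral_square_about_mean[of "\<lambda>x. u x - g x" 0] int np
          integrable_fit[OF u bu cell_lmeasurable(1)] unfolding m by simp
      then show ?thesis
        unfolding d by (simp add: power2_commute)
    qed
    then have "(\<Sum>i=1..n. \<bar>?v i - discretize n g i\<bar>\<^sup>2 / real n)
        \<le> (\<Sum>i=1..n. LINT x|lebesgue_on (cell n i). (u x - g x)\<^sup>2)"
      by (intro sum_mono)
    also have "\<dots> = (LINT x|lebesgue_on Omega. (u x - g x)\<^sup>2)"
      by (rule integral_Omega_cells[OF n _ integrable_fit[OF u bu Omega_lmeasurable(1)], symmetric]) simp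
    finally show ?thesis by (simp add: sum_divide_distrib)
  qed
  have fit2: "(\<Sum>i=1..n. LINT x|lebesgue_on (cell n i). (g x - discretize n g i)\<^sup>2)
      \<le> 2 * M * (\<Sum>i=1..n. LINT x|lebesgue_on (cell n i). \<bar>g x - discretize n g i\<bar>)"
    unfolding sum_distrib_left
  proof (intro sum_mono)
    fix i
    have b: "\<bar>g x - discretize n g i\<bar> \<le> 2 * M" for x
      using g_bounded[of x] abs_discretize_le[OF n g_measurable g_bounded, of i] by linarith
    have "(LINT x|lebesgue_on (cell n i). (g x - discretize n g i)\<^sup>2)
        \<le> (LINT x|lebesgue_on (cell n i). 2 * M * \<bar>g x - discretize n g i\<bar>)"
    proof (intro integral_mono)
      show "(g x - discretize n g i)\<^sup>2 \<le> 2 * M * \<bar>g x - discretize n g i\<bar>" for x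
        using mult_right_mono[OF b[of x] abs_ge_zero[of "g x - discretize n g i"]]
        by (simp add: power2_eq_square abs_mult[symmetric])
      then have "\<bar>(g x - discretize n g i)\<^sup>2\<bar> \<le> 2 * M * (2 * M)" for x
        using b[of x] by (smt (verit) mult_left_mono zero_le_power2)
      then show "integrable (lebesgue_on (cell n i)) (\<lambda>x. (g x - discretize n g i)\<^sup>2)"
        by (rule integrable_lebesgue_on_bounded[OF cell_lmeasurable(1), rotated]) measurable
      have "integrable (lebesgue_on (cell n i)) (\<lambda>x. \<bar>g x - discretize n g i\<bar>)"
        by (rule integrable_lebesgue_on_bounded[OF cell_lmeasurable(1), of _ "2 * M"]) (use b in simp_all)
      then show "integrable (lebesgue_on (cell n i)) (\<lambda>x. 2 * M * \<bar>g x - discretize n g i\<bar>)"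
        by simp
    qed
    then show "(LINT x|lebesgue_on (cell n i). (g x - discretize n g i)\<^sup>2)
        \<le> 2 * M * (LINT x|lebesgue_on (cell n i). \<bar>g x - discretize n g i\<bar>)"
      by simp
  qed
  have reg: "(\<Sum>i=1..n. \<Sum>j=1..n. discretize_kernel n K i j * \<bar>?v j - ?v i\<bar> powr p) / (real n)\<^sup>2
      \<le> (LINT z|lebesgue_on (Omega \<times> Omega). K z * \<bar>u (snd z) - u (fst z)\<bar> powr p)
        + (2 * M) powr p * (\<Sum>i=1..n. \<Sum>j=1..n.
        LINT z|lebesgue_on (cell n i \<times> cell n j). \<bar>K z - discretize_kernel n K i j\<bar>)"
  proof -
    have "discretize_kernel n K i j * \<bar>?v j - ?v i\<bar> powr p / (real n)\<^sup>2
      \<le> (LINT z|lebesgue_on (cell n i \<times> cell n j). K z * \<bar>u (snd z) - u (fst z)\<bar> powr p)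
        + (2 * M) powr p * (LINT z|lebesgue_on (cell n i \<times> cell n j). \<bar>K z - discretize_kernel n K i j\<bar>)" for i j
    proof -
      let ?Q = "cell n i \<times> cell n j" and ?k = "discretize_kernel n K i j"
      let ?w = "\<lambda>z. \<bar>u (snd z) - u (fst z)\<bar> powr p"
      interpret finite_measure "lebesgue_on ?Q"
        by (rule finite_measure_lebesgue_on[OF cell_lmeasurable(2)])
      note bnd = integrable_lebesgue_on_bounded[OF cell_lmeasurable(2)]
      have m: "measure (lebesgue_on ?Q) (space (lebesgue_on ?Q)) = 1 / (real n)\<^sup>2"
        by (simp only: measure_lebesgue_on_space[OF cell_Times_borel] measure_cell)
      have bd: "\<bar>u (snd z) - u (fst z)\<bar> \<le> 2 * M" for z :: "real \<times> real"
        using bu[of "snd z"] bu[of "fst z"] by linarith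
      have bw: "?w z \<le> (2 * M) powr p" for z :: "real \<times> real"
        using bd[of z] p by (intro powr_mono2) auto
      have bK: "\<bar>K z - ?k\<bar> \<le> kb" for z
        using K_nonneg[of z] K_bounded[of z] discretize_kernel_bounds[OF n, of i j] by (auto simp: abs_le_iff)
      have iw: "integrable (lebesgue_on ?Q) ?w"
        by (rule bnd[of _ "(2 * M) powr p"]) (use bw in simp_all)
      have iu: "integrable (lebesgue_on ?Q) (\<lambda>z. u (snd z))" "integrable (lebesgue_on ?Q) (\<lambda>z. u (fst z))"
        by (rule bnd[of _ M], simp, rule bu)+
      have iKw: "integrable (lebesgue_on ?Q) (\<lambda>z. K z * ?w z)"
        by (rule integrable_reg[OF u bu cell_lmeasurable(2)])
      have iK: "integrable (lebesgue_on ?Q) (\<lambda>z. \<bar>K z - ?k\<bar>)"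
        by (rule bnd[of _ kb]) (use bK in simp_all)
      have fin: "emeasure lborel (cell n i) < \<infinity>" for i by (simp add: emeasure_cell)
      \<comment> \<open>The pair of cell means is itself obtained by averaging over the product
        cell, which is what makes Jensen applicable to the difference
        \<open>?v j - ?v i\<close>.\<close>
      have mean: "(LINT z|lebesgue_on ?Q. u (snd z) - u (fst z)) / (1 / (real n)\<^sup>2) = ?v j - ?v i"
        using iu integral_Times_fst_snd[OF cell_borel cell_borel fin fin u bu] np
        by (simp add: measure_cell discretize_def power2_eq_square algebra_simps)
      have "\<bar>?v j - ?v i\<bar> powr p \<le> (LINT z|lebesgue_on ?Q. ?w z) / (1 / (real n)\<^sup>2)"
        using abs_mean_powr_le[OF p _ _ iw] iu np unfolding m mean by simp
      then have "?k * (\<bar>?v j - ?v i\<bar> powr p / (real n)\<^sup>2) \<le> ?k * (LINT z|lebesgue_on ?Q. ?w z)"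
        using np discretize_kernel_bounds(1)[OF n] by (intro mult_left_mono) (auto simp: field_simps)
      also have "\<dots> = (LINT z|lebesgue_on ?Q. ?k * ?w z)" by simp
      \<comment> \<open>The constant weight \<open>?k\<close> is traded for \<open>K\<close>. The
        error is at most \<open>?w z * \<bar>K z - ?k\<bar>\<close>, and \<open>?w\<close> is
        bounded uniformly, so no regularity of \<open>u\<close> is called upon.\<close>
      also have "\<dots> \<le> (LINT z|lebesgue_on ?Q. K z * ?w z + (2 * M) powr p * \<bar>K z - ?k\<bar>)"
      proof (intro integral_mono)
        fix z
        have "?k * ?w z \<le> K z * ?w z + ?w z * \<bar>K z - ?k\<bar>"
        proof -
          have "?w z * (?k - K z) \<le> ?w z * \<bar>K z - ?k\<bar>" by (intro mult_left_mono) auto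
          then show ?thesis by (simp add: algebra_simps)
        qed
        also have "\<dots> \<le> K z * ?w z + (2 * M) powr p * \<bar>K z - ?k\<bar>"
          using bw[of z] by (intro add_left_mono mult_right_mono) auto
        finally show "?k * ?w z \<le> K z * ?w z + (2 * M) powr p * \<bar>K z - ?k\<bar>" .
      qed (use iw iKw iK in simp_all)
      also have "\<dots> = (LINT z|lebesgue_on ?Q. K z * ?w z) + (2 * M) powr p * (LINT z|lebesgue_on ?Q. \<bar>K z - ?k\<bar>)"
        using iKw iK by simp
      finally show ?thesis by simp
    qed
    then have "(\<Sum>i=1..n. \<Sum>j=1..n. discretize_kernel n K i j * \<bar>?v j - ?v i\<bar> powr p / (real n)\<^sup>2)
      \<le> (\<Sum>i=1..n. \<Sum>j=1..n. (LINT z|lebesgue_on (cell n i \<times> cell n j). K z * \<bar>u (snd z) - u (fst z)\<bar> powr p)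
        + (2 * M) powr p * (LINT z|lebesgue_on (cell n i \<times> cell n j). \<bar>K z - discretize_kernel n K i j\<bar>))"
      by (intro sum_mono)
    moreover have "(\<Sum>i=1..n. \<Sum>j=1..n. LINT z|lebesgue_on (cell n i \<times> cell n j). K z * \<bar>u (snd z) - u (fst z)\<bar> powr p)
      = (LINT z|lebesgue_on (Omega \<times> Omega). K z * \<bar>u (snd z) - u (fst z)\<bar> powr p)"
      by (rule integral_Omega_Times_cells[OF n _ integrable_reg[OF u bu Omega_lmeasurable(2)], symmetric]) simp
    ultimately show ?thesis
      by (simp add: sum_divide_distrib sum.distrib sum_distrib_left)
  qed
  let ?A = "\<Sum>i=1..n. \<bar>?v i - discretize n g i\<bar>\<^sup>2"
    and ?B = "\<Sum>i=1..n. LINT x|lebesgue_on (cell n i). (g x - discretize n g i)\<^sup>2"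
    and ?D = "\<Sum>i=1..n. \<Sum>j=1..n. discretize_kernel n K i j * \<bar>?v j - ?v i\<bar> powr p"
  have "real_energy lam p g K (interpolate n ?v)
      = 1 / (2 * lam) * (?A / real n + ?B) + 1 / (2 * p) * (?D / (real n)\<^sup>2)"
    unfolding real_energy_interpolate[OF n] discrete_energy_def by (simp add: algebra_simps)
  also have "\<dots> \<le> 1 / (2 * lam) * ((LINT x|lebesgue_on Omega. (u x - g x)\<^sup>2)
        + 2 * M * (\<Sum>i=1..n. LINT x|lebesgue_on (cell n i). \<bar>g x - discretize n g i\<bar>))
      + 1 / (2 * p) * ((LINT z|lebesgue_on (Omega \<times> Omega). K z * \<bar>u (snd z) - u (fst z)\<bar> powr p)
        + (2 * M) powr p * (\<Sum>i=1..n. \<Sum>j=1..n.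
        LINT z|lebesgue_on (cell n i \<times> cell n j). \<bar>K z - discretize_kernel n K i j\<bar>))"
    using lam p by (intro add_mono mult_left_mono fit1 fit2 reg) auto
  finally show ?thesis
    unfolding real_energy_def by (simp add: distrib_left)
qed

end

lemma bounded_Lp_space_2:
  assumes [measurable]: "v \<in> borel_measurable borel" and bv: "\<And>x. \<bar>v x\<bar> \<le> c"
  shows "v \<in> Lp_space 2 Omega"
proof -
  have "(\<integral>\<^sup>+x. ennreal (\<bar>v x\<bar> powr 2) \<partial>lebesgue_on Omega) \<le> (\<integral>\<^sup>+x. ennreal (c powr 2) \<partial>lebesgue_on Omega)"
    by (intro nn_integral_mono ennreal_leI powr_mono2) (use bv in auto)
  also have "\<dots> < \<infinity>"
    by (simp add: emeasure_restrict_space emeasure_Omega ennreal_mult_less_top)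
  finally show ?thesis
    by (auto simp: Lp_space_def Lp_norm_def Let_def borel_measurable_lebesgue_onI)
qed

section \<open>Galerkin error and boundedness of the minimizer\<close>

context bounded_problem
begin

lemma M_nonneg: "M \<ge> 0"
  using g_bounded[of 0] by linarith

text \<open>The midpoint of \<open>u\<close> and the interpolant competes against \<open>u\<close>,
  so strong convexity bounds the squared distance by \<open>4 * lam\<close> times the energy gap;
  this factor gives the constants \<open>4 * M\<close> and
  \<open>2 * lam * (2 * M) powr p / p\<close>. Minimality of \<open>u\<close> is asked only among
  bounded Borel functions: the midpoint is one, and this is the property that the truncated
  minimizer provides.\<close>

lemma galerkin_error:
  assumes n: "n \<ge> 1" and u[measurable]: "u \<in> borel_measurable borel" and bu: "\<And>x. \<bar>u x\<bar> \<le> M"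
    and u_min: "\<And>v. v \<in> borel_measurable borel \<Longrightarrow> bounded (range v) \<Longrightarrow>
      real_energy lam p g K u \<le> real_energy lam p g K v"
    and w: "is_arg_min (discrete_energy n lam p (discretize n g) (discretize_kernel n K)) (\<lambda>v. v \<in> vecs n) w"
  shows "(LINT x|lebesgue_on Omega. (interpolate n w x - u x)\<^sup>2)
    \<le> 4 * M * (\<Sum>i=1..n. LINT x|lebesgue_on (cell n i). \<bar>g x - discretize n g i\<bar>)
      + 2 * lam * (2 * M) powr p / p * (\<Sum>i=1..n. \<Sum>j=1..n.
          LINT z|lebesgue_on (cell n i \<times> cell n j). \<bar>K z - discretize_kernel n K i j\<bar>)"
    (is "?L \<le> 4 * M * ?eg + 2 * lam * (2 * M) powr p / p * ?eK")
proof -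
  let ?W = "real_energy lam p g K" and ?I = "interpolate n w"
  \<comment> \<open>A bound for \<open>u\<close> and the interpolant at once, as the midpoint
    inequality wants. It depends on \<open>n\<close> and \<open>w\<close>, but does not enter the
    final estimate.\<close>
  define c where "c = M + (\<Sum>i=1..n. \<bar>w i\<bar>)"
  have bI: "\<bar>?I x\<bar> \<le> c" for x
    using interpolate_bounded[of n w x] M_nonneg by (simp add: c_def)
  have buc: "\<bar>u x\<bar> \<le> c" for x
    using bu[of x] by (simp add: c_def add_increasing2 sum_nonneg)
  have "?W u \<le> ?W (\<lambda>x. (?I x + u x) / 2)"
  proof (rule u_min)
    have "\<bar>(?I x + u x) / 2\<bar> \<le> c" for x
      using bI[of x] buc[of x] by (auto simp: abs_le_iff)
    then show "bounded (range (\<lambda>x. (?I x + u x) / 2))"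
      unfolding bounded_iff by (intro exI[of _ c]) auto
  qed measurable
  also have "\<dots> \<le> (?W ?I + ?W u) / 2 - 1 / (8 * lam) * ?L"
    by (rule real_energy_midpoint[OF interpolate_measurable u bI buc])
  finally have "1 / (8 * lam) * ?L \<le> (?W ?I - ?W u) / 2" by (simp add: field_simps)
  then have L: "?L \<le> 4 * lam * (?W ?I - ?W u)" using lam by (simp add: field_simps)
  \<comment> \<open>Elements of \<open>vecs n\<close> are \<open>undefined\<close> outside
    \<open>{1..n}\<close>, so the cell means are restricted before they can compete with
    \<open>w\<close>. Interpolation does not see the difference.\<close>
  define v where "v = restrict (discretize n u) {1..n}"
  have "v \<in> vecs n" by (simp add: v_def vecs_def)
  then have "discrete_energy n lam p (discretize n g) (discretize_kernel n K) w
      \<le> discrete_energy n lam p (discretize n g) (discretize_kernel n K) v"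
    using w by (auto simp: is_arg_min_def not_less)
  then have "?W ?I \<le> ?W (interpolate n v)"
    by (simp add: real_energy_interpolate[OF n])
  also have "interpolate n v = interpolate n (discretize n u)"
    by (rule interpolate_cong) (simp add: v_def)
  also have "?W (interpolate n (discretize n u)) \<le> ?W u + M / lam * ?eg + (2 * M) powr p / (2 * p) * ?eK"
    by (rule real_energy_interpolate_discretize_le[OF n u bu])
  finally have "4 * lam * (?W ?I - ?W u) \<le> 4 * lam * (M / lam * ?eg + (2 * M) powr p / (2 * p) * ?eK)"
    using lam by (intro mult_left_mono) auto
  also have "\<dots> = 4 * M * ?eg + 2 * lam * (2 * M) powr p / p * ?eK"
    using lam by (simp add: field_simps)
  finally show ?thesis using L by linarith
qed

lemma energy_bounded:
  assumes [measurable]: "v \<in> borel_measurable borel" and bv: "\<And>x. \<bar>v x\<bar> \<le> c"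
  shows "energy lam p g K v = ereal (real_energy lam p g K v)"
  by (intro energy_eq_real_energy borel_measurable_lebesgue_onI integrable_reg[OF _ bv Omega_lmeasurable(2)]) measurable

text \<open>Truncation at level \<open>M\<close> does not increase the energy, so a minimizer is bounded by \<open>M\<close>.\<close>

lemma minimizer_truncation:
  assumes u[measurable]: "u \<in> borel_measurable borel" and uL2: "u \<in> Lp_space 2 Omega"
    and u_min: "\<And>v. v \<in> borel_measurable borel \<Longrightarrow> bounded (range v) \<Longrightarrow>
      energy lam p g K u \<le> energy lam p g K v"
  obtains t where "t \<in> borel_measurable borel" "\<And>x. \<bar>t x\<bar> \<le> M" "AE x in lebesgue_on Omega. u x = t x"
    and "\<And>v. v \<in> borel_measurable borel \<Longrightarrow> bounded (range v) \<Longrightarrow>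
      real_energy lam p g K t \<le> real_energy lam p g K v"
proof -
  let ?W = "real_energy lam p g K"
  define t where "t x = max (- M) (min M (u x))" for x
  have t[measurable]: "t \<in> borel_measurable borel" unfolding t_def[abs_def] by measurable
  have bt: "\<bar>t x\<bar> \<le> M" for x using M_nonneg by (auto simp: t_def)
  \<comment> \<open>Comparison with the zero function shows that the energy of \<open>u\<close> is
    finite, which rules out the infinite branch of \<open>nonlocal_reg\<close> although
    \<open>u\<close> may still be unbounded.\<close>
  have "energy lam p g K u \<le> ereal (?W (\<lambda>x. 0))"
    using u_min[of "\<lambda>x. 0"] energy_bounded[of "\<lambda>x. 0" 0] by simp
  then have iu: "integrable (lebesgue_on (Omega \<times> Omega)) (\<lambda>z. K z * \<bar>u (snd z) - u (fst z)\<bar> powr p)"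
    by (auto simp: energy_def nonlocal_reg_def case_prod_unfold split: if_splits)
  have Wu: "energy lam p g K u = ereal (?W u)"
    by (intro energy_eq_real_energy borel_measurable_lebesgue_onI iu) measurable
  have i2: "integrable (lebesgue_on Omega) (\<lambda>x. (u x)\<^sup>2)"
  proof (rule integrableI_bounded)
    have "(\<integral>\<^sup>+x. ennreal (norm ((u x)\<^sup>2)) \<partial>lebesgue_on Omega)
        = (\<integral>\<^sup>+x. ennreal (\<bar>u x\<bar> powr 2) \<partial>lebesgue_on Omega)"
      by (intro nn_integral_cong) (simp add: powr_numeral)
    also have "\<dots> < \<infinity>"
      using uL2 by (auto simp: Lp_space_def Lp_norm_def Let_def less_top split: if_splits)
    finally show "(\<integral>\<^sup>+x. ennreal (norm ((u x)\<^sup>2)) \<partial>lebesgue_on Omega) < \<infinity>" .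
  qed (intro borel_measurable_lebesgue_onI, measurable)
  have ib: "integrable (lebesgue_on Omega) (\<lambda>x. 2 * (u x)\<^sup>2 + 2 * M\<^sup>2)"
  proof -
    interpret finite_measure "lebesgue_on Omega"
      by (rule finite_measure_lebesgue_on[OF Omega_lmeasurable(1)])
    show ?thesis using i2 by simp
  qed
  have ibd: "integrable (lebesgue_on Omega) (\<lambda>x. (u x - f x)\<^sup>2)"
    if [measurable]: "f \<in> borel_measurable borel" and bf: "\<And>x. \<bar>f x\<bar> \<le> M" for f
  proof (rule Bochner_Integration.integrable_bound[OF ib])
    show "(\<lambda>x. (u x - f x)\<^sup>2) \<in> borel_measurable (lebesgue_on Omega)"
      by (intro borel_measurable_lebesgue_onI) measurable
    have "(u x - f x)\<^sup>2 \<le> 2 * (u x)\<^sup>2 + 2 * M\<^sup>2" for x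
    proof -
      have "(f x)\<^sup>2 \<le> M\<^sup>2" using power_mono[OF bf[of x] abs_ge_zero, of 2] by simp
      moreover have "0 \<le> (u x + f x)\<^sup>2" by simp
      ultimately show ?thesis by (simp add: power2_eq_square algebra_simps)
    qed
    then show "AE x in lebesgue_on Omega. norm ((u x - f x)\<^sup>2) \<le> norm (2 * (u x)\<^sup>2 + 2 * M\<^sup>2)"
      by simp
  qed
  have fit: "(LINT x|lebesgue_on Omega. (t x - g x)\<^sup>2) + (LINT x|lebesgue_on Omega. (u x - t x)\<^sup>2)
      \<le> (LINT x|lebesgue_on Omega. (u x - g x)\<^sup>2)"
  proof -
    \<comment> \<open>\<open>t x\<close> is the point of the interval nearest to \<open>u x\<close>,
      and \<open>g x\<close> lies in that interval, so the cross term of the expanded square is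
      nonnegative.\<close>
    have "(t x - g x)\<^sup>2 + (u x - t x)\<^sup>2 \<le> (u x - g x)\<^sup>2" for x
    proof -
      have "0 \<le> (u x - t x) * (t x - g x)"
        using g_bounded[of x] by (cases "u x > M"; cases "u x < - M")
          (auto simp: t_def abs_le_iff max_def min_def mult_nonpos_nonpos split: if_splits)
      then show ?thesis by (simp add: power2_eq_square algebra_simps)
    qed
    then have "(LINT x|lebesgue_on Omega. (t x - g x)\<^sup>2 + (u x - t x)\<^sup>2) \<le> (LINT x|lebesgue_on Omega. (u x - g x)\<^sup>2)"
      using integrable_fit[OF t bt Omega_lmeasurable(1)] ibd[OF t bt] ibd[OF g_measurable g_bounded]
      by (intro integral_mono) auto
    then show ?thesis
      using integrable_fit[OF t bt Omega_lmeasurable(1)] ibd[OF t bt] by simp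
  qed
  have reg: "(LINT z|lebesgue_on (Omega \<times> Omega). K z * \<bar>t (snd z) - t (fst z)\<bar> powr p)
     \<le> (LINT z|lebesgue_on (Omega \<times> Omega). K z * \<bar>u (snd z) - u (fst z)\<bar> powr p)"
  proof (rule integral_mono[OF integrable_reg[OF t bt Omega_lmeasurable(2)] iu])
    fix z
    have "\<bar>t (snd z) - t (fst z)\<bar> \<le> \<bar>u (snd z) - u (fst z)\<bar>"
      using M_nonneg by (auto simp: t_def max_def min_def)
    then show "K z * \<bar>t (snd z) - t (fst z)\<bar> powr p \<le> K z * \<bar>u (snd z) - u (fst z)\<bar> powr p"
      using K_nonneg p by (intro mult_left_mono powr_mono2) auto
  qed
  have W: "?W t + 1 / (2 * lam) * (LINT x|lebesgue_on Omega. (u x - t x)\<^sup>2) \<le> ?W u"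
  proof -
    have "1 / (2 * lam) * ((LINT x|lebesgue_on Omega. (t x - g x)\<^sup>2) + (LINT x|lebesgue_on Omega. (u x - t x)\<^sup>2))
      \<le> 1 / (2 * lam) * (LINT x|lebesgue_on Omega. (u x - g x)\<^sup>2)"
      using lam by (intro mult_left_mono fit) auto
    moreover have "1 / (2 * p) * (LINT z|lebesgue_on (Omega \<times> Omega). K z * \<bar>t (snd z) - t (fst z)\<bar> powr p)
      \<le> 1 / (2 * p) * (LINT z|lebesgue_on (Omega \<times> Omega). K z * \<bar>u (snd z) - u (fst z)\<bar> powr p)"
      using p by (intro mult_left_mono reg) auto
    ultimately show ?thesis unfolding real_energy_def distrib_left by linarith
  qed
  have le: "?W u \<le> ?W v" if v: "v \<in> borel_measurable borel" "bounded (range v)" for v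
  proof -
    obtain c where c: "\<And>x. \<bar>v x\<bar> \<le> c" using v(2) by (auto simp: bounded_iff)
    show ?thesis using u_min[OF v] energy_bounded[OF v(1) c] Wu by simp
  qed
  have br: "bounded (range t)" unfolding bounded_iff using bt by auto
  have nn: "0 \<le> (LINT x|lebesgue_on Omega. (u x - t x)\<^sup>2)" by simp
  \<comment> \<open>Truncation lowers the energy by at least this term, while \<open>t\<close> is
    itself an admissible competitor; hence \<open>u\<close> and \<open>t\<close> agree almost
    everywhere.\<close>
  have "1 / (2 * lam) * (LINT x|lebesgue_on Omega. (u x - t x)\<^sup>2) \<le> 0"
    using W le[OF t br] by linarith
  then have "(LINT x|lebesgue_on Omega. (u x - t x)\<^sup>2) = 0"
    using nn lam by (simp add: divide_le_0_iff)
  then have "AE x in lebesgue_on Omega. (u x - t x)\<^sup>2 = 0"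
    using integral_nonneg_eq_0_iff_AE[OF ibd[OF t bt]] by simp
  then have "AE x in lebesgue_on Omega. u x = t x" by (auto elim: eventually_mono)
  moreover have "?W t \<le> ?W v" if "v \<in> borel_measurable borel" "bounded (range v)" for v
  proof -
    have "0 \<le> 1 / (2 * lam) * (LINT x|lebesgue_on Omega. (u x - t x)\<^sup>2)" using nn lam by simp
    then show ?thesis using W le[OF that] by linarith
  qed
  ultimately show thesis using that[OF t bt] by blast
qed

end

section \<open>Passing to Borel representatives\<close>

lemma (in complete_measure) measurable_cong_AE:
  assumes f: "f \<in> M \<rightarrow>\<^sub>M N" and eq: "AE x in M. f x = g x" and g: "\<And>x. x \<in> space M \<Longrightarrow> g x \<in> space N"
  shows "g \<in> M \<rightarrow>\<^sub>M N"
proof (rule measurableI)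
  fix A assume "A \<in> sets N"
  then have m: "f -` A \<inter> space M \<in> sets M" by (rule measurable_sets[OF f])
  have "AE x in M. x \<in> f -` A \<inter> space M \<longleftrightarrow> x \<in> g -` A \<inter> space M"
    using eq by eventually_elim auto
  then show "g -` A \<inter> space M \<in> sets M" by (rule in_sets_AE[OF _ m]) simp
qed (rule g)

lemma borel_measurable_lebesgue_on_cong_AE:
  fixes f g :: "'a::euclidean_space \<Rightarrow> real"
  assumes S: "S \<in> sets borel" and f: "f \<in> borel_measurable (lebesgue_on S)"
    and eq: "AE x in lebesgue_on S. f x = g x"
  shows "g \<in> borel_measurable (lebesgue_on S)"
proof -
  have S': "S \<in> sets lebesgue" using S by simp
  have "(\<lambda>x. if x \<in> S then f x else 0) \<in> borel_measurable lebesgue"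
    by (rule borel_measurable_if_I[OF f S'])
  moreover have "AE x in lebesgue. (if x \<in> S then f x else 0) = (if x \<in> S then g x else 0)"
    using eq S' by (auto simp: AE_restrict_space_iff elim!: eventually_mono)
  ultimately have "(\<lambda>x. if x \<in> S then g x else 0) \<in> borel_measurable lebesgue"
    by (rule completion.measurable_cong_AE) simp
  then show ?thesis by (rule borel_measurable_if_D)
qed

lemma borel_representative:
  fixes f :: "'a::euclidean_space \<Rightarrow> real"
  assumes S: "S \<in> sets borel" and f: "f \<in> borel_measurable (lebesgue_on S)"
  obtains f' where "f' \<in> borel_measurable borel" "AE x in lebesgue_on S. f x = f' x"
proof -
  have "(\<lambda>x. if x \<in> S then f x else 0) \<in> borel_measurable lebesgue"
    using S by (intro borel_measurable_if_I[OF f]) simp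
  then obtain f' where f': "f' \<in> borel_measurable lborel" "AE x in lborel. (if x \<in> S then f x else 0) = f' x"
    using completion_ex_borel_measurable_real by blast
  have "AE x in lebesgue_on S. f x = f' x"
    unfolding AE_lebesgue_on_iff[OF S] using f'(2) by eventually_elim auto
  with f'(1) show thesis by (intro that) auto
qed

text \<open>Clamping a Borel representative to the interval from \<open>a\<close> to
  \<open>b\<close> changes it only on a null subset of \<open>S\<close> and outside
  \<open>S\<close>, and makes the bounds hold at every point.\<close>

lemma borel_representative_Icc:
  fixes f :: "'a::euclidean_space \<Rightarrow> real"
  assumes S: "S \<in> sets borel" and f: "f \<in> borel_measurable (lebesgue_on S)"
    and bd: "AE x in lebesgue_on S. a \<le> f x \<and> f x \<le> b" and ab: "a \<le> b"
  obtains f' where "f' \<in> borel_measurable borel" "AE x in lebesgue_on S. f x = f' x"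
    "\<And>x. a \<le> f' x" "\<And>x. f' x \<le> b"
proof -
  obtain f0 where f0[measurable]: "f0 \<in> borel_measurable borel" and eq: "AE x in lebesgue_on S. f x = f0 x"
    using borel_representative[OF S f] by blast
  have m: "(\<lambda>x. max a (min b (f0 x))) \<in> borel_measurable borel" by measurable
  have e: "AE x in lebesgue_on S. f x = max a (min b (f0 x))"
    using bd eq by eventually_elim auto
  show thesis by (rule that[OF m e]) (use ab in auto)
qed

text \<open>A cylinder over a null set is null even with an unbounded second factor, because
  \<open>0 * \<infinity> = 0\<close> in \<open>ennreal\<close>.\<close>

lemma AE_lborel_fst_snd:
  fixes P :: "'a::euclidean_space \<Rightarrow> bool"
  assumes "AE x in lborel. P x"
  shows "AE z in (lborel :: ('a \<times> 'b::euclidean_space) measure). P (fst z)"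
    and "AE z in (lborel :: ('b \<times> 'a) measure). P (snd z)"
proof -
  obtain N where N: "N \<in> null_sets lborel" "{x \<in> space lborel. \<not> P x} \<subseteq> N"
    using assms by (auto elim: AE_E simp: null_sets_def)
  then have N': "N \<in> sets borel" "emeasure lborel N = 0" by auto
  have "N \<times> (UNIV :: 'b set) \<in> null_sets lborel" "(UNIV :: 'b set) \<times> N \<in> null_sets lborel"
    using N' by (auto intro!: null_setsI simp: emeasure_lborel_Times borel_Times)
  then show "AE z in (lborel :: ('a \<times> 'b) measure). P (fst z)"
    "AE z in (lborel :: ('b \<times> 'a) measure). P (snd z)"
    using N(2) by - (rule AE_I', assumption, auto)+
qed

lemma AE_lebesgue_on_Times:
  fixes A :: "'a::euclidean_space set"
  assumes A: "A \<in> sets borel" and P: "AE x in lebesgue_on A. P x"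
  shows "AE z in lebesgue_on (A \<times> A). P (fst z) \<and> P (snd z)"
proof -
  have AA: "A \<times> A \<in> sets borel" using A by (intro borel_Times)
  have "AE x in lborel. x \<in> A \<longrightarrow> P x" using P unfolding AE_lebesgue_on_iff[OF A] .
  note AE_lborel_fst_snd[OF this]
  then show ?thesis
    unfolding AE_lebesgue_on_iff[OF AA] by eventually_elim auto
qed

text \<open>Only the primed kernel and function are taken to be measurable. The other integrand is
  then measurable by completeness of Lebesgue measure, so the integrability test in
  \<open>nonlocal_reg\<close> has the same outcome on both sides.\<close>

lemma energy_cong_AE:
  assumes v: "AE x in lebesgue_on Omega. v x = v' x" and g: "AE x in lebesgue_on Omega. g x = g' x"
    and K: "AE z in lebesgue_on (Omega \<times> Omega). K z = K' z"
    and [measurable]: "v' \<in> borel_measurable borel" "K' \<in> borel_measurable borel"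
  shows "energy lam p g K v = energy lam p g' K' v'"
proof -
  have "(\<integral>\<^sup>+x. ennreal (\<bar>v x - g x\<bar> powr 2) \<partial>lebesgue_on Omega)
      = (\<integral>\<^sup>+x. ennreal (\<bar>v' x - g' x\<bar> powr 2) \<partial>lebesgue_on Omega)"
    by (rule nn_integral_cong_AE) (use v g in eventually_elim, simp)
  then have L: "L2_norm (\<lambda>x. v x - g x) = L2_norm (\<lambda>x. v' x - g' x)"
    by (simp add: L2_norm_def Lp_norm_def)
  let ?f = "\<lambda>z. K z * \<bar>v (snd z) - v (fst z)\<bar> powr p"
    and ?f' = "\<lambda>z. K' z * \<bar>v' (snd z) - v' (fst z)\<bar> powr p"
  have eq: "AE z in lebesgue_on (Omega \<times> Omega). ?f' z = ?f z"
    using AE_lebesgue_on_Times[OF Omega_borel(1) v] K by eventually_elim simp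
  have m': "?f' \<in> borel_measurable (lebesgue_on (Omega \<times> Omega))"
    by (intro borel_measurable_lebesgue_onI) measurable
  then have m: "?f \<in> borel_measurable (lebesgue_on (Omega \<times> Omega))"
    by (rule borel_measurable_lebesgue_on_cong_AE[OF Omega_borel(2) _ eq])
  have "nonlocal_reg p v K = nonlocal_reg p v' K'"
    using integrable_cong_AE[OF m' m eq] integral_cong_AE[OF m' m eq]
    by (simp add: nonlocal_reg_def case_prod_unfold)
  with L show ?thesis by (simp add: energy_def)
qed

lemma discretize_cong_AE:
  assumes n: "n \<ge> 1" "i \<in> {1..n}" and g: "g \<in> borel_measurable (lebesgue_on Omega)"
    and g': "g' \<in> borel_measurable borel" and eq: "AE x in lebesgue_on Omega. g x = g' x"
  shows "discretize n g i = discretize n g' i"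
proof -
  have "AE x in lebesgue_on (cell n i). g x = g' x"
    using eq cell_subset_Omega[OF n]
    unfolding AE_lebesgue_on_iff[OF cell_borel] AE_lebesgue_on_iff[OF Omega_borel(1)]
    by (auto elim!: eventually_mono)
  then have "(LINT x|lebesgue_on (cell n i). g x) = (LINT x|lebesgue_on (cell n i). g' x)"
    by (intro integral_cong_AE measurable_restrict_mono[OF g cell_subset_Omega[OF n]]
        borel_measurable_lebesgue_onI[OF g'])
  then show ?thesis by (simp add: discretize_def)
qed

lemma discretize_kernel_cong_AE:
  assumes n: "n \<ge> 1" "i \<in> {1..n}" "j \<in> {1..n}" and K: "K \<in> borel_measurable (lebesgue_on (Omega \<times> Omega))"
    and K': "K' \<in> borel_measurable borel" and eq: "AE z in lebesgue_on (Omega \<times> Omega). K z = K' z"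
  shows "discretize_kernel n K i j = discretize_kernel n K' i j"
proof -
  have sub: "cell n i \<times> cell n j \<subseteq> Omega \<times> Omega"
    using cell_subset_Omega[OF n(1)] n by (intro Sigma_mono) auto
  have "AE z in lebesgue_on (cell n i \<times> cell n j). K z = K' z"
    using eq sub
    unfolding AE_lebesgue_on_iff[OF cell_Times_borel] AE_lebesgue_on_iff[OF Omega_borel(2)]
    by (auto elim!: eventually_mono)
  then have "(LINT z|lebesgue_on (cell n i \<times> cell n j). K z) = (LINT z|lebesgue_on (cell n i \<times> cell n j). K' z)"
    by (intro integral_cong_AE measurable_restrict_mono[OF K sub] borel_measurable_lebesgue_onI[OF K'])
  then show ?thesis by (simp add: discretize_kernel_def)
qed

lemma discrete_energy_cong:
  assumes "\<And>i. i \<in> {1..n} \<Longrightarrow> g i = g' i" "\<And>i j. i \<in> {1..n} \<Longrightarrow> j \<in> {1..n} \<Longrightarrow> K i j = K' i j"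
  shows "discrete_energy n lam p g K = discrete_energy n lam p g' K'"
proof
  fix v
  have "(\<Sum>i=1..n. \<bar>v i - g i\<bar>\<^sup>2) = (\<Sum>i=1..n. \<bar>v i - g' i\<bar>\<^sup>2)"
    by (intro sum.cong refl) (simp only: assms(1))
  moreover have "(\<Sum>i=1..n. \<Sum>j=1..n. K i j * \<bar>v j - v i\<bar> powr p) = (\<Sum>i=1..n. \<Sum>j=1..n. K' i j * \<bar>v j - v i\<bar> powr p)"
    by (intro sum.cong refl) (simp only: assms(2))
  ultimately show "discrete_energy n lam p g K v = discrete_energy n lam p g' K' v"
    by (simp only: discrete_energy_def)
qed

text \<open>Smoothness is given as a shift estimate for every Borel representative, since the
  representatives are chosen inside the proof. The target exponent \<open>e\<close> is free below
  both orders, so that all claimed rates for Lipschitz and BV data are instances.\<close>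

lemma galerkin_rate:
  fixes g u :: "real \<Rightarrow> real" and K :: "real \<times> real \<Rightarrow> real"
  assumes lam: "lam > 0" and p: "p \<ge> 1"
    and g: "g \<in> Lp_space \<infinity> Omega"
    and K: "K \<in> borel_measurable (lebesgue_on (Omega \<times> Omega))"
    and K_bounds: "\<And>z. z \<in> Omega \<times> Omega \<Longrightarrow> 0 \<le> K z \<and> K z \<le> kb"
    and u_min: "is_arg_min (energy lam p g K) (\<lambda>v. v \<in> Lp_space 2 Omega) u"
    and un_min: "\<And>n. n \<ge> 1 \<Longrightarrow>
      is_arg_min (discrete_energy n lam p (discretize n g) (discretize_kernel n K))
        (\<lambda>v. v \<in> vecs n) (un n)"
    and s: "0 < s" "0 < s'" and e: "e \<le> s" "e \<le> s'"
    and g_shift: "\<And>g'. g' \<in> borel_measurable borel \<Longrightarrow> AE x in lebesgue_on Omega. g x = g' x \<Longrightarrow>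
      \<exists>C\<ge>0. \<forall>z. shift_L1 Omega g' z \<le> ennreal (C * norm z powr s)"
    and K_shift: "\<And>K'. K' \<in> borel_measurable borel \<Longrightarrow> AE z in lebesgue_on (Omega \<times> Omega). K z = K' z \<Longrightarrow>
      \<exists>C\<ge>0. \<forall>z. shift_L1 (Omega \<times> Omega) K' z \<le> ennreal (C * norm z powr s')"
  shows "\<exists>C>0. \<forall>n\<ge>1. (L2_norm (\<lambda>x. interpolate n (un n) x - u x))\<^sup>2 \<le> C * real n powr (- e)"
proof -
  have gm: "g \<in> borel_measurable (lebesgue_on Omega)" using g by (simp add: Lp_space_def)
  have "esssup (lebesgue_on Omega) (\<lambda>x. ennreal \<bar>g x\<bar>) < \<infinity>"
    using g by (simp add: Lp_space_def Lp_norm_def)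
  then obtain M0 where M0: "esssup (lebesgue_on Omega) (\<lambda>x. ennreal \<bar>g x\<bar>) = ennreal M0" "M0 \<ge> 0"
    by (cases "esssup (lebesgue_on Omega) (\<lambda>x. ennreal \<bar>g x\<bar>)") auto
  have "AE x in lebesgue_on Omega. ennreal \<bar>g x\<bar> \<le> ennreal M0"
    using esssup_AE[of "\<lambda>x. ennreal \<bar>g x\<bar>" "lebesgue_on Omega"] M0(1) by simp
  then have "AE x in lebesgue_on Omega. - M0 \<le> g x \<and> g x \<le> M0"
    by eventually_elim (use M0(2) in auto)
  then obtain g' where g': "g' \<in> borel_measurable borel" "AE x in lebesgue_on Omega. g x = g' x"
    "\<And>x. - M0 \<le> g' x" "\<And>x. g' x \<le> M0"
    using borel_representative_Icc[OF Omega_borel(1) gm, of "- M0" M0] M0(2) by auto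
  have "(0, 0) \<in> Omega \<times> Omega" by (simp add: Omega_def)
  then have kb: "0 \<le> kb" using K_bounds by fastforce
  have "AE z in lebesgue_on (Omega \<times> Omega). 0 \<le> K z \<and> K z \<le> kb"
    by (rule AE_I2) (use K_bounds in \<open>auto simp: space_restrict_space\<close>)
  then obtain K' where K': "K' \<in> borel_measurable borel" "AE z in lebesgue_on (Omega \<times> Omega). K z = K' z"
    "\<And>z. 0 \<le> K' z" "\<And>z. K' z \<le> kb"
    using borel_representative_Icc[OF Omega_borel(2) K _ kb] by blast
  have "\<bar>g' x\<bar> \<le> M0" for x using g'(3)[of x] g'(4)[of x] by linarith
  then interpret bounded_problem lam p M0 kb g' K'
    by unfold_locales (use lam p g'(1) K'(1,3,4) in simp_all)
  have uL: "u \<in> Lp_space 2 Omega" using u_min by (simp add: is_arg_min_def)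
  then have um: "u \<in> borel_measurable (lebesgue_on Omega)" by (simp add: Lp_space_def)
  then obtain u' where u': "u' \<in> borel_measurable borel" "AE x in lebesgue_on Omega. u x = u' x"
    using borel_representative[OF Omega_borel(1)] by blast
  have "(\<integral>\<^sup>+x. ennreal (\<bar>u x\<bar> powr 2) \<partial>lebesgue_on Omega) = (\<integral>\<^sup>+x. ennreal (\<bar>u' x\<bar> powr 2) \<partial>lebesgue_on Omega)"
    by (rule nn_integral_cong_AE) (use u'(2) in eventually_elim, simp)
  then have u'L: "u' \<in> Lp_space 2 Omega"
    using uL borel_measurable_lebesgue_onI[OF u'(1)] by (simp add: Lp_space_def Lp_norm_def)
  have u'_min: "energy lam p g' K' u' \<le> energy lam p g' K' v"
    if v: "v \<in> borel_measurable borel" "bounded (range v)" for v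
  proof -
    obtain c where c: "\<And>x. \<bar>v x\<bar> \<le> c" using v(2) by (auto simp: bounded_iff)
    have "energy lam p g K u \<le> energy lam p g K v"
      using u_min bounded_Lp_space_2[OF v(1) c] by (auto simp: is_arg_min_def not_less)
    moreover have "energy lam p g K u = energy lam p g' K' u'"
      by (rule energy_cong_AE[OF u'(2) g'(2) K'(2) u'(1) K'(1)])
    moreover have "energy lam p g K v = energy lam p g' K' v"
      by (rule energy_cong_AE[OF _ g'(2) K'(2) v(1) K'(1)]) simp
    ultimately show ?thesis by simp
  qed
  obtain t where t: "t \<in> borel_measurable borel" "\<And>x. \<bar>t x\<bar> \<le> M0" "AE x in lebesgue_on Omega. u' x = t x"
    and t_min: "\<And>v. v \<in> borel_measurable borel \<Longrightarrow> bounded (range v) \<Longrightarrow>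
      real_energy lam p g' K' t \<le> real_energy lam p g' K' v"
    using minimizer_truncation[OF u'(1) u'L u'_min] by blast
  have ut: "AE x in lebesgue_on Omega. u x = t x"
    using u'(2) t(3) by eventually_elim simp
  obtain Cg where Cg: "Cg \<ge> 0" "\<And>z. shift_L1 Omega g' z \<le> ennreal (Cg * norm z powr s)"
    using g_shift[OF g'(1,2)] by blast
  obtain CK where CK: "CK \<ge> 0" "\<And>z. shift_L1 (Omega \<times> Omega) K' z \<le> ennreal (CK * norm z powr s')"
    using K_shift[OF K'(1,2)] by blast
  define a where "a = 4 * M0"
  define b where "b = 2 * lam * (2 * M0) powr p / p"
  have ab: "a \<ge> 0" "b \<ge> 0" using M0(2) lam p by (auto simp: a_def b_def)
  \<comment> \<open>The summand \<open>1\<close> keeps \<open>C\<close> positive even if both error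
    constants vanish.\<close>
  define C where "C = a * (2 * Cg) + b * (4 * 2 powr s' * CK) + 1"
  have "C > 0" using ab Cg(1) CK(1) by (simp add: C_def add_nonneg_pos)
  moreover have "(L2_norm (\<lambda>x. interpolate n (un n) x - u x))\<^sup>2 \<le> C * real n powr (- e)" if n: "n \<ge> 1" for n
  proof -
    have de: "discrete_energy n lam p (discretize n g) (discretize_kernel n K)
        = discrete_energy n lam p (discretize n g') (discretize_kernel n K')"
      by (rule discrete_energy_cong)
         (auto intro!: discretize_cong_AE[OF n _ gm g'(1,2)] discretize_kernel_cong_AE[OF n _ _ K K'(1,2)])
    have "(L2_norm (\<lambda>x. interpolate n (un n) x - u x))\<^sup>2
        = (LINT x|lebesgue_on Omega. (interpolate n (un n) x - u x)\<^sup>2)"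
      by (intro L2_norm_square borel_measurable_diff um borel_measurable_lebesgue_onI interpolate_measurable)
    also have "\<dots> = (LINT x|lebesgue_on Omega. (interpolate n (un n) x - t x)\<^sup>2)"
    proof (rule integral_cong_AE)
      show "AE x in lebesgue_on Omega. (interpolate n (un n) x - u x)\<^sup>2 = (interpolate n (un n) x - t x)\<^sup>2"
        using ut by eventually_elim simp
    qed (intro borel_measurable_power borel_measurable_diff um borel_measurable_lebesgue_onI[OF t(1)]
          borel_measurable_lebesgue_onI[OF interpolate_measurable])+
    also have "\<dots> \<le> a * (\<Sum>i=1..n. LINT x|lebesgue_on (cell n i). \<bar>g' x - discretize n g' i\<bar>)
      + b * (\<Sum>i=1..n. \<Sum>j=1..n.
          LINT z|lebesgue_on (cell n i \<times> cell n j). \<bar>K' z - discretize_kernel n K' i j\<bar>)"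
      unfolding a_def b_def
      by (rule galerkin_error[OF n t(1,2) t_min]) (use un_min[OF n] de in simp_all)
    also have "\<dots> \<le> a * (2 * Cg * real n powr (- s)) + b * (4 * 2 powr s' * CK * real n powr (- s'))"
    proof (intro add_mono mult_left_mono ab)
      show "(\<Sum>i=1..n. LINT x|lebesgue_on (cell n i). \<bar>g' x - discretize n g' i\<bar>) \<le> 2 * Cg * real n powr (- s)"
        by (rule sum_deviation_discretize[OF g'(1) g_bounded Cg s(1) n])
      show "(\<Sum>i=1..n. \<Sum>j=1..n. LINT z|lebesgue_on (cell n i \<times> cell n j). \<bar>K' z - discretize_kernel n K' i j\<bar>)
          \<le> 4 * 2 powr s' * CK * real n powr (- s')"
        by (rule sum_deviation_discretize_kernel[OF K'(1) _ CK s(2) n, of kb]) (use K'(3,4) in \<open>simp add: abs_of_nonneg\<close>)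
    qed
    also have "\<dots> \<le> a * (2 * Cg * real n powr (- e)) + b * (4 * 2 powr s' * CK * real n powr (- e))"
      using ab Cg(1) CK(1) n e by (intro add_mono mult_left_mono powr_mono) auto
    also have "\<dots> \<le> C * real n powr (- e)"
      by (simp add: C_def algebra_simps)
    finally show ?thesis .
  qed
  ultimately show ?thesis by blast
qed

lemma bigo_of_rate:
  fixes f :: "nat \<Rightarrow> real"
  assumes "\<exists>C>0. \<forall>n\<ge>1. (f n)\<^sup>2 \<le> C * real n powr e"
  shows "(\<lambda>n. (f n)\<^sup>2) \<in> O(\<lambda>n. real n powr e)"
proof -
  obtain C where "\<forall>n\<ge>1. (f n)\<^sup>2 \<le> C * real n powr e" using assms by blast
  then show ?thesis
    by (intro bigoI[of _ C]) (auto simp: eventually_at_top_linorder)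
qed

theorem theorem5p2:
  fixes lam p :: real
    and g J :: "real \<Rightarrow> real"
    and K :: "real \<times> real \<Rightarrow> real"
    and u :: "real \<Rightarrow> real"
    and un :: "nat \<Rightarrow> nat \<Rightarrow> real"
  assumes lam: "lam > 0"
    and p: "1 \<le> p" "p \<le> 2"
    and g_bdd: "g \<in> Lp_space \<infinity> Omega"
    and J_meas: "J \<in> borel_measurable (lebesgue_on Omega)"
    and J_nonneg: "\<And>t. t \<in> Omega \<Longrightarrow> J t \<ge> 0"
    and J_bdd: "bounded (J ` Omega)"
    and K_J: "\<And>x y. x \<in> Omega \<Longrightarrow> y \<in> Omega \<Longrightarrow> K (x, y) = J \<bar>x - y\<bar>"
    and u_min: "is_arg_min (energy lam p g K) (\<lambda>v. v \<in> Lp_space 2 Omega) u"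
    and un_min: "\<And>n. n \<ge> 1 \<Longrightarrow>
      is_arg_min (discrete_energy n lam p (discretize n g) (discretize_kernel n K))
        (\<lambda>v. v \<in> vecs n) (un n)"
  shows
    "(\<forall>s q s' q' :: real.
        0 < s \<and> s \<le> 1 \<and> 2 / (3 - p) \<le> q \<and> q \<le> 2 \<and> g \<in> Lip_space s (ereal q) Omega \<and>
        p < 2 \<and> 0 < s' \<and> s' \<le> 1 \<and> 1 \<le> q' \<and> K \<in> Lip_space s' (ereal q') (Omega \<times> Omega) \<longrightarrow>
        (\<exists>C>0. \<forall>n\<ge>1. (L2_norm (\<lambda>x. interpolate n (un n) x - u x))\<^sup>2
           \<le> C * real n powr (- min (s * q / 2) (min s' (s' * q' * (1 - p / 2))))))
     \<and>
     (p < 2 \<and> g \<in> BV_space Omega \<and>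
        K \<in> Lp_space \<infinity> (Omega \<times> Omega) \<and> K \<in> BV_space (Omega \<times> Omega) \<longrightarrow>
        (\<lambda>n. (L2_norm (\<lambda>x. interpolate n (un n) x - u x))\<^sup>2) \<in> O(\<lambda>n. real n powr (p / 2 - 1)))
     \<and>
     (\<forall>(s::real) (q::real) (s'::real) (q'::ereal).
        0 < s \<and> s \<le> 1 \<and> 2 / (3 - p) \<le> q \<and> q \<le> 2 \<and> g \<in> Lip_space s (ereal q) Omega \<and>
        0 < s' \<and> s' \<le> 1 \<and> exponent_bound p \<le> q' \<and> K \<in> Lip_space s' q' (Omega \<times> Omega) \<longrightarrow>
        (\<exists>C>0. \<forall>n\<ge>1. (L2_norm (\<lambda>x. interpolate n (un n) x - u x))\<^sup>2
           \<le> C * real n powr (- min (s * q / 2) s')))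
     \<and>
     (\<forall>(s'::real) (q'::ereal).
        g \<in> BV_space Omega \<and>
        0 < s' \<and> s' \<le> 1 \<and> exponent_bound p \<le> q' \<and> K \<in> Lip_space s' q' (Omega \<times> Omega) \<longrightarrow>
        (\<lambda>n. (L2_norm (\<lambda>x. interpolate n (un n) x - u x))\<^sup>2) \<in> O(\<lambda>n. real n powr (- min (1 / 2) s')))"
proof -
  obtain kb where kb: "\<And>t. t \<in> Omega \<Longrightarrow> \<bar>J t\<bar> \<le> kb"
    using J_bdd by (auto simp: bounded_iff)
  have K_bounds: "0 \<le> K z \<and> K z \<le> kb" if zO: "z \<in> Omega \<times> Omega" for z
  proof -
    obtain x y where z: "z = (x, y)" "x \<in> Omega" "y \<in> Omega" using zO by auto
    then have "\<bar>x - y\<bar> \<in> Omega" by (auto simp: Omega_def)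
    from J_nonneg[OF this] kb[OF this] show ?thesis
      using K_J[OF z(2,3)] by (simp add: z(1))
  qed
  note rate = galerkin_rate[OF lam p(1) g_bdd _ K_bounds u_min un_min]
  have unit: "emeasure lborel Omega \<le> 1" "emeasure lborel (Omega \<times> Omega) \<le> 1"
    by (simp_all add: emeasure_Omega)
  have g_Lip: "\<exists>C\<ge>0. \<forall>z. shift_L1 Omega g' z \<le> ennreal (C * norm z powr s)"
    if "0 < s" "2 / (3 - p) \<le> q" "g \<in> Lip_space s (ereal q) Omega"
      "g' \<in> borel_measurable borel" "AE x in lebesgue_on Omega. g x = g' x" for s q g'
  proof -
    \<comment> \<open>As \<open>p\<close> is at least \<open>1\<close>, the admissible exponents
      \<open>q\<close> are at least \<open>1\<close>, which the passage to L1 requires.\<close>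
    have "1 \<le> 2 / (3 - p)" using p by (simp add: field_simps)
    then have "1 \<le> ereal q" using that(2) by (simp add: one_ereal_def)
    then show ?thesis
      by (rule Lip_space_shift_L1[OF Omega_borel(1) unit(1) that(4,5) _ that(1,3)]) blast
  qed
  have g_BV: "\<exists>C\<ge>0. \<forall>z. shift_L1 Omega g' z \<le> ennreal (C * norm z powr 1)"
    if "g \<in> BV_space Omega" "g' \<in> borel_measurable borel" "AE x in lebesgue_on Omega. g x = g' x" for g'
    by (rule BV_space_shift_L1_real[OF Omega_borel(1) that(2,3,1)]) blast
  have K_Lip: "\<exists>C\<ge>0. \<forall>z. shift_L1 (Omega \<times> Omega) K' z \<le> ennreal (C * norm z powr s')"
    if "0 < s'" "1 \<le> q'" "K \<in> Lip_space s' q' (Omega \<times> Omega)"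
      "K' \<in> borel_measurable borel" "AE z in lebesgue_on (Omega \<times> Omega). K z = K' z" for s' q' K'
    by (rule Lip_space_shift_L1[OF Omega_borel(2) unit(2) that(4,5,2,1,3)]) blast
  have K_BV: "\<exists>C\<ge>0. \<forall>z. shift_L1 (Omega \<times> Omega) K' z \<le> ennreal (C * norm z powr 1)"
    if "K \<in> BV_space (Omega \<times> Omega)"
      "K' \<in> borel_measurable borel" "AE z in lebesgue_on (Omega \<times> Omega). K z = K' z" for K'
    by (rule BV_space_shift_L1_Times[OF Omega_borel(1) Omega_borel(1) that(2,3,1)]) blast
  have K_meas: "K \<in> borel_measurable (lebesgue_on (Omega \<times> Omega))"
    if "K \<in> Lip_space s' q' (Omega \<times> Omega) \<or> K \<in> BV_space (Omega \<times> Omega)" for s' q'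
    using that by (auto simp: Lip_space_def BV_space_def Lp_space_def)
  \<comment> \<open>The claimed exponent for \<open>g\<close> lies below the order \<open>s\<close>
    that is actually attained, because \<open>q\<close> is at most \<open>2\<close>.\<close>
  have sq: "s * q / 2 \<le> s" if "0 < s" "q \<le> 2" for s q :: real
    using mult_left_mono[OF that(2), of s] that(1) by simp
  have q'1: "1 \<le> q'" if "exponent_bound p \<le> q'" for q'
  proof -
    have "1 \<le> 2 / (2 - p)" if "p \<noteq> 2" using p that by (simp add: field_simps)
    then have "1 \<le> exponent_bound p" by (simp add: exponent_bound_def one_ereal_def)
    then show ?thesis using that by (rule order_trans)
  qed
  show ?thesis
  proof (intro conjI allI impI; (elim conjE)?)
    fix s q s' q' :: real
    assume h: "0 < s" "s \<le> 1" "2 / (3 - p) \<le> q" "q \<le> 2" "g \<in> Lip_space s (ereal q) Omega"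
      "p < 2" "0 < s'" "s' \<le> 1" "1 \<le> q'" "K \<in> Lip_space s' (ereal q') (Omega \<times> Omega)"
    show "\<exists>C>0. \<forall>n\<ge>1. (L2_norm (\<lambda>x. interpolate n (un n) x - u x))\<^sup>2
           \<le> C * real n powr (- min (s * q / 2) (min s' (s' * q' * (1 - p / 2))))"
      by (rule rate[OF _ _ _ h(1,7) _ _ g_Lip[OF h(1,3,5)] K_Lip[OF h(7) _ h(10)]])
         (use K_meas h(9,10) sq[OF h(1,4)] in \<open>auto simp: one_ereal_def\<close>)
  next
    assume h: "p < 2" "g \<in> BV_space Omega" "K \<in> BV_space (Omega \<times> Omega)"
    \<comment> \<open>Both orders are \<open>1\<close> for BV data, and \<open>1 - p / 2\<close> is
      at most \<open>1\<close>.\<close>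
    have "\<exists>C>0. \<forall>n\<ge>1. (L2_norm (\<lambda>x. interpolate n (un n) x - u x))\<^sup>2 \<le> C * real n powr (- (1 - p / 2))"
      by (rule rate[OF _ _ _ _ _ _ _ g_BV[OF h(2)] K_BV[OF h(3)]]) (use K_meas h(3) p in auto)
    then show "(\<lambda>n. (L2_norm (\<lambda>x. interpolate n (un n) x - u x))\<^sup>2) \<in> O(\<lambda>n. real n powr (p / 2 - 1))"
      by (intro bigo_of_rate) simp
  next
    fix s q s' :: real and q' :: ereal
    assume h: "0 < s" "s \<le> 1" "2 / (3 - p) \<le> q" "q \<le> 2" "g \<in> Lip_space s (ereal q) Omega"
      "0 < s'" "s' \<le> 1" "exponent_bound p \<le> q'" "K \<in> Lip_space s' q' (Omega \<times> Omega)"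
    show "\<exists>C>0. \<forall>n\<ge>1. (L2_norm (\<lambda>x. interpolate n (un n) x - u x))\<^sup>2
           \<le> C * real n powr (- min (s * q / 2) s')"
      by (rule rate[OF _ _ _ h(1,6) _ _ g_Lip[OF h(1,3,5)] K_Lip[OF h(6) q'1[OF h(8)] h(9)]])
         (use K_meas h(9) sq[OF h(1,4)] in auto)
  next
    fix s' :: real and q' :: ereal
    assume h: "g \<in> BV_space Omega" "0 < s'" "s' \<le> 1" "exponent_bound p \<le> q'"
      "K \<in> Lip_space s' q' (Omega \<times> Omega)"
    have "\<exists>C>0. \<forall>n\<ge>1. (L2_norm (\<lambda>x. interpolate n (un n) x - u x))\<^sup>2 \<le> C * real n powr (- min (1 / 2) s')"
      by (rule rate[OF _ _ _ _ h(2) _ _ g_BV[OF h(1)] K_Lip[OF h(2) q'1[OF h(4)] h(5)]])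
         (use K_meas h(5) in auto)
    then show "(\<lambda>n. (L2_norm (\<lambda>x. interpolate n (un n) x - u x))\<^sup>2) \<in> O(\<lambda>n. real n powr (- min (1 / 2) s'))"
      by (rule bigo_of_rate)
  qed
qed

end
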